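(* Let $\kappa>0$ and $\gamma\in(0,2]$, and let $\theta_0,S\in C^\infty(\mathbb{T}^3)$ be an initial datum and a forcing term with zero mean. If $\theta^{(\lambda)}$ and $\theta^{(0)}$ are smooth solutions of the damped fractional magnetogeostrophic equation $$\partial_t\theta+u\cdot\nabla\theta+\lambda\mathcal{D}\theta+\kappa\Lambda^{\gamma}\theta=S,\qquad u=\mathcal{M}[\theta],\qquad\theta(x,0)=\theta_0(x)\quad\text{on }\mathbb{T}^3\times(0,\infty)$$ for $\lambda>0$ and for $\lambda=0$ respectively, then $$\lim_{\lambda\to0}\|(\theta^{(\lambda)}-\theta^{(0)})(\cdot,t)\|_{H^s}=0$$ for all $s\ge0$ and all $t\ge0$.
   Context: $\mathbb{T}^3=[-\pi,\pi]^3$ with periodic boundary conditions, $\Lambda=\sqrt{-\Delta}$, $\mathcal{D}=\Lambda+\mathbf{1}$ with $\mathbf 1$ the identity. $S=S(x)$ is time-independent; solutions have zero spatial mean, and $\theta$ and $u$ are assumed to have zero vertical ($x_3$) mean. $H^s$ is the space of mean-zero functions with norm $\|f\|_{H^s}=\|\Lambda^sf\|_{L^2}$. The velocity $u=\mathcal{M}[\theta]$ is given by Fourier multipliers, $u_j=(\widehat{\mathcal{M}_j}\hat\theta)^\vee$, $j=1,2,3$, where for $k=(k_1,k_2,k_3)\in\mathbb{Z}^3$ with $k_3\neq0$ $$\widehat{\mathcal{M}}_1(k)=\frac{k_2k_3|k|^2-k_1k_3(k_2^2+\nu|k|^4)}{D(k)},\quad \widehat{\mathcal{M}}_2(k)=\frac{-k_1k_3|k|^2-k_2k_3(k_2^2+\nu|k|^4)}{D(k)},\quad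 \widehat{\mathcal{M}}_3(k)=\frac{(k_1^2+k_2^2)(k_2^2+\nu|k|^4)}{D(k)},$$ $D(k)=|k|^2k_3^2+(k_2^2+\nu|k|^4)^2$, $\nu=1$, and $\widehat{\mathcal{M}}_j(k)=0$ when $k_3=0$. *)

theory Defs
  imports "HOL-Analysis.Analysis"
begin

section \<open>Functions on the torus\<close>

text \<open>Functions on the torus are functions on \<open>\<real>\<^sup>3\<close> that are \<open>2\<pi>\<close>-periodic in each coordinate;
  integrals are taken over the fundamental cell, without normalisation.\<close>

definition torus_cell :: "(real ^ 3) set" where
  "torus_cell = cbox (\<chi> i. - pi) (\<chi> i. pi)"

definition periodic :: "(real ^ 3 \<Rightarrow> real) \<Rightarrow> bool" where
  "periodic f \<longleftrightarrow> (\<forall>x j. f (x + axis j (2 * pi)) = f x)"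

text \<open>\<open>C\<^sup>n\<close>-regularity by iterating partial derivatives. It is used below only for sets \<open>A\<close> on which
  the derivative relative to \<open>A\<close> is unique: the whole space and the closed half-space \<open>t \<ge> 0\<close>, where
  time derivatives at \<open>t = 0\<close> are one-sided.\<close>

fun Cn_on :: "nat \<Rightarrow> 'a::euclidean_space set \<Rightarrow> ('a \<Rightarrow> real) \<Rightarrow> bool" where
  "Cn_on 0 A f \<longleftrightarrow> continuous_on A f"
| "Cn_on (Suc n) A f \<longleftrightarrow>
     f differentiable_on A \<and>
     (\<forall>b\<in>Basis. Cn_on n A (\<lambda>x. frechet_derivative f (at x within A) b))"

definition smooth_on :: "'a::euclidean_space set \<Rightarrow> ('a \<Rightarrow> real) \<Rightarrow> bool" where
  "smooth_on A f \<longleftrightarrow> (\<forall>n. Cn_on n A f)"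

definition smooth_torus :: "(real ^ 3 \<Rightarrow> real) \<Rightarrow> bool" where
  "smooth_torus f \<longleftrightarrow> periodic f \<and> smooth_on UNIV f"

definition zero_mean :: "(real ^ 3 \<Rightarrow> real) \<Rightarrow> bool" where
  "zero_mean f \<longleftrightarrow> (LINT x:torus_cell|lborel. f x) = 0"

definition zero_vertical_mean :: "(real ^ 3 \<Rightarrow> real) \<Rightarrow> bool" where
  "zero_vertical_mean f \<longleftrightarrow> (\<forall>a b. (LINT c:{- pi..pi}|lborel. f (vector [a, b, c])) = 0)"

definition L2_norm :: "(real ^ 3 \<Rightarrow> real) \<Rightarrow> real" where
  "L2_norm f = sqrt (LINT x:torus_cell|lborel. (f x)\<^sup>2)"

definition grad :: "(real ^ 3 \<Rightarrow> real) \<Rightarrow> real ^ 3 \<Rightarrow> real ^ 3" where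
  "grad f x = (\<chi> j. frechet_derivative f (at x) (axis j 1))"


section \<open>Fourier multipliers\<close>

definition real_freq :: "int ^ 3 \<Rightarrow> real ^ 3" where
  "real_freq k = (\<chi> i. of_int (k $ i))"

definition fourier_coeff :: "(real ^ 3 \<Rightarrow> real) \<Rightarrow> int ^ 3 \<Rightarrow> complex" where
  "fourier_coeff f k =
     (LINT x:torus_cell|lborel. of_real (f x) * cis (- (real_freq k \<bullet> x))) / of_real ((2 * pi) ^ 3)"

text \<open>All symbols used below are real and even in \<open>k\<close>, so for real-valued \<open>f\<close> the series itself is
  real; taking the real part only adjusts the type.\<close>

definition fourier_multiplier :: "(int ^ 3 \<Rightarrow> real) \<Rightarrow> (real ^ 3 \<Rightarrow> real) \<Rightarrow> real ^ 3 \<Rightarrow> real" where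
  "fourier_multiplier m f x =
     Re (\<Sum>\<^sub>\<infinity>k\<in>UNIV. of_real (m k) * fourier_coeff f k * cis (real_freq k \<bullet> x))"

text \<open>Powers of \<open>\<Lambda> = sqrt (- \<Delta>)\<close>, acting on mean-zero functions. Since \<open>0 powr s = 0\<close> for every \<open>s\<close>,
  the zero mode is discarded also for \<open>s = 0\<close>, where the operator is the identity on smooth mean-zero
  functions.\<close>

definition Lambda_pow :: "real \<Rightarrow> (real ^ 3 \<Rightarrow> real) \<Rightarrow> real ^ 3 \<Rightarrow> real" where
  "Lambda_pow s = fourier_multiplier (\<lambda>k. norm (real_freq k) powr s)"

definition damping :: "(real ^ 3 \<Rightarrow> real) \<Rightarrow> real ^ 3 \<Rightarrow> real" where
  "damping f x = Lambda_pow 1 f x + f x"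

definition Hs_norm :: "real \<Rightarrow> (real ^ 3 \<Rightarrow> real) \<Rightarrow> real" where
  "Hs_norm s f = L2_norm (Lambda_pow s f)"


section \<open>The magnetogeostrophic equation\<close>

definition MG_denom :: "real \<Rightarrow> real ^ 3 \<Rightarrow> real" where
  "MG_denom \<nu> k = (norm k)\<^sup>2 * (k $ 3)\<^sup>2 + ((k $ 2)\<^sup>2 + \<nu> * norm k ^ 4)\<^sup>2"

definition MG_symbol :: "real \<Rightarrow> real ^ 3 \<Rightarrow> real ^ 3" where
  "MG_symbol \<nu> k =
     (if k $ 3 = 0 then 0
      else vector
        [(k $ 2 * k $ 3 * (norm k)\<^sup>2 - k $ 1 * k $ 3 * ((k $ 2)\<^sup>2 + \<nu> * norm k ^ 4)) / MG_denom \<nu> k,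
         (- k $ 1 * k $ 3 * (norm k)\<^sup>2 - k $ 2 * k $ 3 * ((k $ 2)\<^sup>2 + \<nu> * norm k ^ 4)) / MG_denom \<nu> k,
         ((k $ 1)\<^sup>2 + (k $ 2)\<^sup>2) * ((k $ 2)\<^sup>2 + \<nu> * norm k ^ 4) / MG_denom \<nu> k])"

text \<open>The velocity \<open>u = M[\<theta>]\<close>, with \<open>\<nu> = 1\<close>.\<close>

definition MG_velocity :: "(real ^ 3 \<Rightarrow> real) \<Rightarrow> real ^ 3 \<Rightarrow> real ^ 3" where
  "MG_velocity f x = (\<chi> j. fourier_multiplier (\<lambda>k. MG_symbol 1 (real_freq k) $ j) f x)"

text \<open>Smooth solutions of the initial value problem with damping parameter \<open>\<mu>\<close>. For smooth data,
  smoothness is understood up to the initial time; the equation is imposed for \<open>t > 0\<close>. The first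
  argument of \<open>\<theta>\<close> is time, and its values at negative times are irrelevant.\<close>

definition smooth_MG_solution ::
  "real \<Rightarrow> real \<Rightarrow> real \<Rightarrow> (real ^ 3 \<Rightarrow> real) \<Rightarrow> (real ^ 3 \<Rightarrow> real) \<Rightarrow> (real \<Rightarrow> real ^ 3 \<Rightarrow> real) \<Rightarrow> bool"
  where
  "smooth_MG_solution \<kappa> \<gamma> \<mu> S \<theta>\<^sub>0 \<theta> \<longleftrightarrow>
     smooth_on ({0..} \<times> UNIV) (\<lambda>(t, x). \<theta> t x) \<and>
     (\<forall>t\<ge>0. periodic (\<theta> t) \<and> zero_mean (\<theta> t) \<and> zero_vertical_mean (\<theta> t) \<and>
            (\<forall>j. zero_vertical_mean (\<lambda>x. MG_velocity (\<theta> t) x $ j))) \<and>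
     (\<forall>x. \<theta> 0 x = \<theta>\<^sub>0 x) \<and>
     (\<forall>t>0. \<forall>x.
        deriv (\<lambda>\<tau>. \<theta> \<tau> x) t + MG_velocity (\<theta> t) x \<bullet> grad (\<theta> t) x
          + \<mu> * damping (\<theta> t) x + \<kappa> * Lambda_pow \<gamma> (\<theta> t) x = S x)"

end

theory Submission
  imports Defs
begin

text \<open>Let \<open>c\<^sub>k(t)\<close> be the Fourier coefficients of \<open>\<theta>\<^sup>\<lambda> - \<theta>\<^sup>0\<close>, and
  let \<open>g = \<Sum> |k|\<^sup>2\<^sup>n |c\<^sub>k|\<^sup>2\<close> with \<open>n\<close> large. The symbol of the velocity is bounded, even
  and divergence free, so the transport term is antisymmetric up to a commutator, and the damping and
  the diffusion of \<open>c\<close> only help. This gives \<open>g' \<le> K (g + g\<^sup>3\<^sup>/\<^sup>2 + \<lambda>)\<close>, where \<open>K\<close> depends on \<open>\<theta>\<^sup>0\<close> but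
  not on \<open>\<theta>\<^sup>\<lambda>\<close>. For \<open>z = g + \<lambda>\<close> the function \<open>z / (1 + z)\<close> then grows at most exponentially from a value
  below \<open>\<lambda>\<close>, so \<open>g\<close> tends to \<open>0\<close> on every bounded time interval. All estimates are made on Fourier
  coefficients; neither Parseval's identity nor Fourier inversion is needed.\<close>

section \<open>Fourier coefficients on the torus\<close>

text \<open>No bound on the damped solution that is uniform in the damping is available beforehand.
  Its coefficients are therefore written as \<open>c + b\<close>, with \<open>b\<close> those of the
  undamped solution, and only \<open>b\<close> may be charged with more than n derivatives. The
  velocity of \<open>c + b\<close> transports \<open>c\<close>, which gives the antisymmetric part;
  in the other product the velocity of \<open>c\<close> acts on \<open>b\<close> and the derivative
  falls on \<open>b\<close>. The power 3/2 appears because the l1 norm of |k| c has to be bounded by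
  the energy itself: one derivative plus six powers of |k| for summability over the lattice is the
  origin of the threshold 7 for n. The damping of \<open>b\<close> has no counterpart in the
  undamped equation; it is the only source, and it is proportional to \<lambda>. Adding \<lambda> to
  the energy turns the inequality with a source into one without. Zero mean removes the frequency 0,
  so that |k| >= 1 wherever a coefficient can be nonzero and higher weights dominate lower
  ones.\<close>

lemma real_freq_simps [simp]:
  "real_freq 0 = 0" "real_freq (k - l) = real_freq k - real_freq l"
  "real_freq (- k) = - real_freq k" "real_freq k $ j = of_int (k $ j)"
  by (simp_all add: real_freq_def vec_eq_iff)

lemma real_freq_eq_0_iff [simp]: "real_freq k = 0 \<longleftrightarrow> k = 0"
  by (simp add: real_freq_def vec_eq_iff)

lemma axis_scale: "axis j h = h *\<^sub>R (axis j 1 :: real ^ 3)"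
  by (simp add: axis_def vec_eq_iff)

lemma inner_axis_real [simp]: "(q::real ^ 3) \<bullet> axis j h = q $ j * h"
  by (simp add: inner_axis)

text \<open>The cell is prolonged by \<open>h\<close> in direction \<open>j\<close> and cut in two
  ways, at \<open>pi\<close> and at \<open>- pi + h\<close>. One piece is the cell or its translate;
  the two remaining slabs differ by a full period and have equal integrals. The bound
  \<open>h \<le> 2 * pi\<close> keeps the cuts inside the prolonged box.\<close>

lemma integral_torus_shift:
  fixes f :: "real ^ 3 \<Rightarrow> 'b::euclidean_space"
  assumes f: "continuous_on UNIV f" and per: "\<And>x. f (x + axis j (2 * pi)) = f x"
    and h: "0 \<le> h" "h \<le> 2 * pi"
  shows "integral torus_cell (\<lambda>x. f (x + axis j h)) = integral torus_cell f"
proof -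
  define a b :: "real ^ 3" where "a = (\<chi> i. - pi)" and "b = (\<chi> i. pi)"
  define B where "B = cbox a (b + axis j h)"
  have int: "f integrable_on B"
    unfolding B_def by (rule integrable_continuous) (rule continuous_on_subset[OF f], simp)
  have basis: "axis j 1 \<in> (Basis :: (real ^ 3) set)"
    by (auto simp: Basis_vec_def)
  have slab: "x \<in> cbox (a + axis j u) (b + axis j v) \<longleftrightarrow>
      (\<forall>i. i \<noteq> j \<longrightarrow> - pi \<le> x $ i \<and> x $ i \<le> pi) \<and> - pi + u \<le> x $ j \<and> x $ j \<le> pi + v" for x u v
    unfolding mem_box_cart a_def b_def axis_def by auto
  have axis0: "axis j 0 = (0 :: real ^ 3)" and axis_add: "axis j u + axis j v = (axis j (u + v) :: real ^ 3)" for u v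
    by (simp_all add: axis_def vec_eq_iff)
  note slabs = slab[of _ 0, unfolded axis0 add_0_right] slab[of _ _ 0, unfolded axis0 add_0_right]
    slab[of _ 0 0, unfolded axis0 add_0_right] slab
  have comp: "x \<bullet> axis j 1 = x $ j" for x :: "real ^ 3"
    by simp
  have 1: "B \<inter> {x. x \<bullet> axis j 1 \<le> pi} = cbox a b"
    using h unfolding set_eq_iff comp B_def Int_iff mem_Collect_eq slabs by auto
  have 2: "B \<inter> {x. x \<bullet> axis j 1 \<ge> pi} = cbox (a + axis j (2*pi)) (b + axis j (h - 2*pi) + axis j (2*pi))"
    using h unfolding set_eq_iff comp B_def Int_iff mem_Collect_eq slabs add.assoc axis_add by auto
  have 3: "B \<inter> {x. x \<bullet> axis j 1 \<le> - pi + h} = cbox a (b + axis j (h - 2*pi))"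
    using h unfolding set_eq_iff comp B_def Int_iff mem_Collect_eq slabs by auto
  have 4: "B \<inter> {x. x \<bullet> axis j 1 \<ge> - pi + h} = cbox (a + axis j h) (b + axis j h)"
    using h unfolding set_eq_iff comp B_def Int_iff mem_Collect_eq slabs by auto
  have "integral B f = integral (cbox a b) f
      + integral (cbox (a + axis j (2*pi)) (b + axis j (h - 2*pi) + axis j (2*pi))) f"
    using integral_split[OF int[unfolded B_def] basis, of pi] 1 2 unfolding B_def by simp
  moreover have "integral B f = integral (cbox a (b + axis j (h - 2*pi))) f
      + integral (cbox (a + axis j h) (b + axis j h)) f"
    using integral_split[OF int[unfolded B_def] basis, of "- pi + h"] 3 4 unfolding B_def by simp
  moreover have "f \<circ> (+) (axis j (2*pi)) = f"
    using per by (auto simp: fun_eq_iff add.commute)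
  hence "integral (cbox (a + axis j (2*pi)) (b + axis j (h - 2*pi) + axis j (2*pi))) f
      = integral (cbox a (b + axis j (h - 2*pi))) f"
    using integral_shift_cbox_plus[of a "b + axis j (h - 2*pi)" f "axis j (2*pi)"] by simp
  ultimately have "integral (cbox (a + axis j h) (b + axis j h)) f = integral (cbox a b) f"
    by simp
  thus ?thesis
    using integral_shift_cbox_plus[of a b f "axis j h"]
    by (simp add: torus_cell_def a_def b_def o_def add.commute)
qed

text \<open>The integral of the translates of \<open>f\<close> is constant in the shift, while the
  Leibniz rule gives the integral of \<open>f'\<close> as its derivative. This replaces an
  integration by parts with boundary terms and asks only for a derivative along one coordinate
  direction.\<close>

lemma integral_torus_derivative:
  fixes f :: "real ^ 3 \<Rightarrow> 'b::euclidean_space"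
  assumes f: "continuous_on UNIV f" and per: "\<And>x. f (x + axis j (2 * pi)) = f x"
    and f': "continuous_on UNIV f'"
    and der: "\<And>x. ((\<lambda>s. f (x + axis j s)) has_vector_derivative f' x) (at 0)"
  shows "integral torus_cell f' = 0"
proof -
  \<comment> \<open>The hypothesis speaks of \<open>s = 0\<close> at every base point; moving the
    base point yields the derivative along the whole line, as the Leibniz rule requires.\<close>
  have der': "((\<lambda>s. f (x + axis j s)) has_vector_derivative f' (x + axis j r)) (at r within U)" for x r U
  proof -
    have "((\<lambda>s. f ((x + axis j r) + axis j (s - r))) has_vector_derivative f' (x + axis j r)) (at r within U)"
      using vector_diff_chain_within[of "\<lambda>s. s - r" 1 r U "\<lambda>s. f ((x + axis j r) + axis j s)"]
        has_vector_derivative_at_within[OF der[of "x + axis j r"]]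
      by (fastforce simp: o_def intro!: derivative_eq_intros)
    moreover have "(x + axis j r) + axis j (s - r) = x + axis j s" for s
      by (simp add: vec_eq_iff axis_def)
    ultimately show ?thesis by simp
  qed
  have cax: "continuous_on A (\<lambda>x. axis j (g x) :: real ^ 3)" if "continuous_on A g"
    for A :: "('c::topological_space) set" and g
    by (subst axis_scale) (intro continuous_intros that)
  have d1: "((\<lambda>s. integral torus_cell (\<lambda>x. f (x + axis j s))) has_vector_derivative
         integral torus_cell (\<lambda>x. f' (x + axis j 0))) (at 0 within {0..2*pi})"
    unfolding torus_cell_def
  proof (rule leibniz_rule_vector_derivative)
    show "continuous_on ({0..2*pi} \<times> cbox (\<chi> i. - pi) (\<chi> i. pi)) (\<lambda>(s, x). f' (x + axis j s))"
      unfolding split_beta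
      by (intro continuous_on_compose2[OF f'] continuous_intros cax) auto
    show "(\<lambda>x. f (x + axis j s)) integrable_on cbox (\<chi> i. - pi) (\<chi> i. pi)" for s
      by (intro integrable_continuous continuous_on_compose2[OF f] continuous_intros) auto
  qed (use der' in auto)
  have d2: "((\<lambda>s. integral torus_cell (\<lambda>x. f (x + axis j s))) has_vector_derivative 0)
      (at 0 within {0..2*pi})"
  proof -
    have "((\<lambda>s::real. integral torus_cell f) has_vector_derivative 0) (at 0 within {0..2*pi})"
      by simp
    thus ?thesis
      by (rule has_vector_derivative_transform[rotated 2])
        (use integral_torus_shift[OF f per] in auto)
  qed
  have axis0: "axis j 0 = (0 :: real ^ 3)"
    by (simp add: axis_def vec_eq_iff)
  \<comment> \<open>Shifts were compared only within one period, so the two derivatives at 0 are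
    one-sided; they agree because 0 is a limit point of the interval.\<close>
  have "at 0 within {0..2*pi} \<noteq> (bot :: real filter)"
    using at_within_Icc_at_right[of 0 "2*pi"] by simp
  from vector_derivative_unique_within[OF this d1 d2] show ?thesis
    by (simp add: axis0)
qed

text \<open>Stated with the gauge integral and complex values, so that the Leibniz rule, uniform
  limits and complex exponentials fit directly. For continuous real functions it agrees with
  \<open>fourier_coeff\<close>.\<close>

definition fcoeff :: "(real ^ 3 \<Rightarrow> complex) \<Rightarrow> int ^ 3 \<Rightarrow> complex" where
  "fcoeff f k = integral torus_cell (\<lambda>x. f x * cis (- (real_freq k \<bullet> x))) / of_real ((2 * pi) ^ 3)"

lemma continuous_on_cis_inner [continuous_intros]:
  "continuous_on A g \<Longrightarrow> continuous_on A (\<lambda>x. cis (g x))"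
  unfolding cis_conv_exp by (intro continuous_intros)

lemma fourier_coeff_eq_fcoeff:
  assumes "continuous_on UNIV f"
  shows "fourier_coeff f k = fcoeff (\<lambda>x. of_real (f x)) k"
proof -
  have "set_integrable lborel torus_cell (\<lambda>x. of_real (f x) * cis (- (real_freq k \<bullet> x)))"
    unfolding torus_cell_def set_integrable_def
    by (intro borel_integrable_compact compact_cbox continuous_intros continuous_on_subset[OF assms]) auto
  from set_borel_integral_eq_integral(2)[OF this] show ?thesis
    by (simp add: fourier_coeff_def fcoeff_def)
qed

lemma cis_real_freq_periodic: "cis (real_freq k \<bullet> (x + axis j (2 * pi))) = cis (real_freq k \<bullet> x)"
proof -
  have "cis (real_freq k \<bullet> (x + axis j (2 * pi))) = cis (real_freq k \<bullet> x) * cis (2 * pi * of_int (k $ j))"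
    by (simp add: inner_add_right cis_mult mult_ac)
  thus ?thesis by (simp add: cis_multiple_2pi)
qed

lemma fcoeff_derivative:
  assumes f: "continuous_on UNIV f" and per: "\<And>x. f (x + axis j (2 * pi)) = f x"
    and f': "continuous_on UNIV f'"
    and der: "\<And>x. ((\<lambda>s. f (x + axis j s)) has_vector_derivative f' x) (at 0)"
  shows "fcoeff f' k = \<i> * of_int (k $ j) * fcoeff f k"
proof -
  let ?e = "\<lambda>x. cis (- (real_freq k \<bullet> x))"
  let ?P' = "\<lambda>x. f' x * ?e x - \<i> * of_int (k $ j) * (f x * ?e x)"
  have ce: "((\<lambda>s. ?e (x + axis j s)) has_vector_derivative - \<i> * of_int (k $ j) * ?e x) (at 0)" for x
  proof -
    have "((\<lambda>s. cis (- (real_freq k \<bullet> x) - k $ j * s)) has_vector_derivative - \<i> * of_int (k $ j) * ?e x) (at 0)"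
      unfolding cis_conv_exp
      by (auto intro!: derivative_eq_intros has_vector_derivative_real_field simp: algebra_simps)
    thus ?thesis by (simp add: inner_add_right)
  qed
  have "integral torus_cell ?P' = 0"
  proof (rule integral_torus_derivative[where f = "\<lambda>x. f x * ?e x"])
    show "f (x + axis j (2 * pi)) * ?e (x + axis j (2 * pi)) = f x * ?e x" for x
      using per[of x] cis_real_freq_periodic[of "-k" x j] by simp
    show "((\<lambda>s. f (x + axis j s) * ?e (x + axis j s)) has_vector_derivative ?P' x) (at 0)" for x
    proof -
      have axis0: "axis j 0 = (0 :: real ^ 3)"
        by (simp add: axis_def vec_eq_iff)
      have "f (x + axis j 0) * (- \<i> * of_int (k $ j) * ?e x) + f' x * ?e (x + axis j 0) = ?P' x"
        by (simp add: algebra_simps axis0)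
      thus ?thesis
        using has_vector_derivative_mult[OF der[of x] ce[of x]] by simp
    qed
  qed (intro continuous_intros f f')+
  moreover have "integral torus_cell ?P' = integral torus_cell (\<lambda>x. f' x * ?e x)
      - \<i> * of_int (k $ j) * integral torus_cell (\<lambda>x. f x * ?e x)"
  proof -
    have i: "(\<lambda>x. g x * ?e x) integrable_on torus_cell" if "continuous_on UNIV g" for g
      unfolding torus_cell_def
      by (intro integrable_continuous continuous_intros continuous_on_subset[OF that]) auto
    show ?thesis
      by (subst integral_diff) (auto intro!: i f f' integrable_on_mult_right)
  qed
  ultimately show ?thesis
    by (simp add: fcoeff_def)
qed

text \<open>For \<open>k \<noteq> 0\<close> the derivative rule for the constant function 1 makes a
  nonzero component of \<open>k\<close> times the integral vanish, so no iterated integral has to be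
  computed.\<close>

lemma integral_cis_real_freq:
  "integral torus_cell (\<lambda>x. cis (real_freq k \<bullet> x)) = (if k = 0 then of_real ((2 * pi) ^ 3) else 0)"
proof (cases "k = 0")
  case True
  have "Henstock_Kurzweil_Integration.content torus_cell = (2 * pi) ^ 3"
    unfolding torus_cell_def by (subst content_cbox_cart) (auto simp: interval_eq_empty_cart not_less)
  thus ?thesis using True
    by (simp add: torus_cell_def scaleR_conv_of_real)
next
  case False
  then obtain j where j: "k $ j \<noteq> 0"
    by (auto simp: vec_eq_iff)
  have "\<i> * of_int ((- k) $ j) * fcoeff (\<lambda>_. 1) (- k) = fcoeff (\<lambda>_. 0) (- k)"
    by (rule fcoeff_derivative[symmetric]) auto
  hence "fcoeff (\<lambda>_. 1) (- k) = 0"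
    using j by (simp add: fcoeff_def)
  thus ?thesis using False
    by (simp add: fcoeff_def)
qed

lemma fcoeff_cis:
  "fcoeff (\<lambda>x. c * cis (real_freq l \<bullet> x)) k = (if k = l then c else 0)"
proof -
  have "(\<lambda>x. c * cis (real_freq l \<bullet> x) * cis (- (real_freq k \<bullet> x))) = (\<lambda>x. c * cis (real_freq (l - k) \<bullet> x))"
    by (auto simp: fun_eq_iff cis_mult inner_diff_left)
  thus ?thesis
    using integral_cis_real_freq[of "l - k"] by (auto simp: fcoeff_def)
qed

lemma continuous_on_fourier_series:
  fixes c :: "int ^ 3 \<Rightarrow> complex"
  assumes c: "(\<lambda>l. norm (c l)) summable_on UNIV"
  shows "continuous_on UNIV (\<lambda>x. \<Sum>\<^sub>\<infinity>l. c l * cis (real_freq l \<bullet> x))"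
proof (rule uniform_limit_theorem)
  show "uniform_limit UNIV (\<lambda>X x. \<Sum>l\<in>X. c l * cis (real_freq l \<bullet> x))
      (\<lambda>x. \<Sum>\<^sub>\<infinity>l. c l * cis (real_freq l \<bullet> x)) (finite_subsets_at_top UNIV)"
    by (rule Weierstrass_m_test_general[OF _ c]) (simp add: norm_mult)
qed (auto intro!: always_eventually continuous_intros)

text \<open>Convolution theorem in an asymmetric form: one factor is an absolutely convergent
  series, the other merely continuous. It is made for the transport term, where the velocity is
  defined by a series and the gradient is just a function. The series converges uniformly on the
  cell and is integrated term by term.\<close>

lemma fcoeff_series_mult:
  fixes c :: "int ^ 3 \<Rightarrow> complex"
  assumes c: "(\<lambda>l. norm (c l)) summable_on UNIV" and h: "continuous_on UNIV h"
  shows "((\<lambda>l. c l * fcoeff h (k - l)) has_sum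
      fcoeff (\<lambda>x. (\<Sum>\<^sub>\<infinity>l. c l * cis (real_freq l \<bullet> x)) * h x) k) UNIV"
proof -
  let ?G = "\<lambda>x. \<Sum>\<^sub>\<infinity>l. c l * cis (real_freq l \<bullet> x)"
  let ?h = "\<lambda>x. h x * cis (- (real_freq k \<bullet> x))"
  let ?g = "\<lambda>l x. c l * cis (real_freq l \<bullet> x) * ?h x"
  have hc: "continuous_on torus_cell ?h"
    by (intro continuous_intros continuous_on_subset[OF h]) auto
  have "compact torus_cell" by (simp add: torus_cell_def)
  then have "bounded (?h ` torus_cell)"
    using hc compact_continuous_image compact_imp_bounded by blast
  then obtain M where M: "\<And>x. x \<in> torus_cell \<Longrightarrow> norm (?h x) \<le> M"
    by (auto simp: bounded_iff)
  have "uniform_limit torus_cell (\<lambda>X x. \<Sum>l\<in>X. ?g l x)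
      (\<lambda>x. \<Sum>\<^sub>\<infinity>l. ?g l x) (finite_subsets_at_top UNIV)"
    by (rule Weierstrass_m_test_general[OF _ summable_on_cmult_left[OF c, of M]])
      (use M in \<open>auto simp: norm_mult intro!: mult_left_mono\<close>)
  moreover have "(\<Sum>\<^sub>\<infinity>l. ?g l x) = ?G x * ?h x" for x
    by (rule infsum_cmult_left, rule abs_summable_summable) (use c in \<open>simp add: norm_mult\<close>)
  ultimately have ul: "uniform_limit torus_cell (\<lambda>X x. \<Sum>l\<in>X. ?g l x)
      (\<lambda>x. ?G x * ?h x) (finite_subsets_at_top UNIV)" by simp
  have gc: "continuous_on torus_cell (?g l)" for l
    by (intro continuous_intros continuous_on_subset[OF h]) auto
  have gcX: "continuous_on torus_cell (\<lambda>x. \<Sum>l\<in>X. ?g l x)" for X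
    by (intro continuous_on_sum gc)
  obtain I J where I: "\<And>X. ((\<lambda>x. \<Sum>l\<in>X. ?g l x) has_integral I X) torus_cell"
    and J: "((\<lambda>x. ?G x * ?h x) has_integral J) torus_cell"
    and lim: "(I \<longlongrightarrow> J) (finite_subsets_at_top UNIV)"
    by (rule uniform_limit_integral_cbox[OF ul[unfolded torus_cell_def] gcX[unfolded torus_cell_def]
          finite_subsets_at_top_neq_bot, folded torus_cell_def]) (rule that)
  define V where "V = complex_of_real ((2 * pi) ^ 3)"
  have V: "V \<noteq> 0"
    by (simp add: V_def)
  have Vf: "integral torus_cell (\<lambda>x. f x * cis (- (real_freq m \<bullet> x))) = V * fcoeff f m" for f m
    unfolding fcoeff_def V_def[symmetric] using V by simp
  have int: "(?g l has_integral (V * (c l * fcoeff h (k - l)))) torus_cell" for l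
  proof -
    have eq: "?g l = (\<lambda>x. c l * (h x * cis (- (real_freq (k - l) \<bullet> x))))"
      by (auto simp: fun_eq_iff cis_mult inner_diff_left mult_ac)
    have "?g l integrable_on torus_cell"
      using gc unfolding torus_cell_def by (intro integrable_continuous)
    moreover have "integral torus_cell (?g l) = V * (c l * fcoeff h (k - l))"
    proof -
      have "integral torus_cell (?g l) = c l * integral torus_cell (\<lambda>x. h x * cis (- (real_freq (k - l) \<bullet> x)))"
        unfolding eq by (rule Henstock_Kurzweil_Integration.integral_mult_right)
      also have "\<dots> = c l * (V * fcoeff h (k - l))"
        by (rule arg_cong[OF Vf])
      finally show ?thesis by (simp only: mult.left_commute)
    qed
    ultimately show ?thesis
      by (simp only: has_integral_integrable_integral)
  qed
  have IX: "I X = (\<Sum>l\<in>X. V * (c l * fcoeff h (k - l)))" if "finite X" for X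
    by (rule has_integral_unique[OF I[of X] has_integral_sum[OF that int]])
  have "((\<lambda>l. V * (c l * fcoeff h (k - l))) has_sum J) UNIV"
    unfolding has_sum_def
    by (rule Lim_transform_eventually[OF lim])
      (use IX in \<open>auto intro!: eventually_finite_subsets_at_top_weakI\<close>)
  from has_sum_cmult_right[OF this, of "inverse V"]
  have "((\<lambda>l. c l * fcoeff h (k - l)) has_sum inverse V * J) UNIV"
    using V by (simp add: mult.assoc[symmetric])
  moreover have "J = integral torus_cell (\<lambda>x. ?G x * ?h x)"
    by (rule integral_unique[OF J, symmetric])
  hence "J = integral torus_cell (\<lambda>x. (?G x * h x) * cis (- (real_freq k \<bullet> x)))"
    by (simp only: mult.assoc)
  hence "inverse V * J = fcoeff (\<lambda>x. ?G x * h x) k"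
    using V unfolding Vf by (simp add: mult.assoc[symmetric])
  ultimately show ?thesis
    by (simp only:)
qed

text \<open>The product rule with the constant factor 1, whose coefficients are concentrated at
  0.\<close>

lemma fcoeff_series:
  fixes c :: "int ^ 3 \<Rightarrow> complex"
  assumes c: "(\<lambda>l. norm (c l)) summable_on UNIV"
  shows "fcoeff (\<lambda>x. \<Sum>\<^sub>\<infinity>l. c l * cis (real_freq l \<bullet> x)) k = c k"
proof -
  have one: "fcoeff (\<lambda>_. 1) l = (if l = 0 then 1 else 0)" for l
    using fcoeff_cis[of 1 0 l] by simp
  have "((\<lambda>l. c l * fcoeff (\<lambda>_. 1) (k - l)) has_sum c k) UNIV"
    by (rule has_sum_cong_neutral[THEN iffD1, of UNIV "{k}" _ "\<lambda>l. c l * fcoeff (\<lambda>_. 1) (k - l)"])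
      (auto simp: one intro!: has_sum_finiteI)
  with fcoeff_series_mult[OF c, of "\<lambda>_. 1" k] show ?thesis
    using has_sum_unique by fastforce
qed

section \<open>Lattice sums\<close>

lemma summable_on_nonneg_comparison:
  fixes f g :: "'a \<Rightarrow> real"
  assumes "g summable_on A" "\<And>x. x \<in> A \<Longrightarrow> 0 \<le> f x" "\<And>x. x \<in> A \<Longrightarrow> f x \<le> g x"
  shows "f summable_on A"
  using summable_on_comparison_test[of g A f] assms by auto

lemma summable_on_product_nonneg:
  fixes f :: "'a \<Rightarrow> real" and g :: "'b \<Rightarrow> real"
  assumes f: "f summable_on A" and g: "g summable_on B"
    and f0: "\<And>x. x \<in> A \<Longrightarrow> 0 \<le> f x" and g0: "\<And>y. y \<in> B \<Longrightarrow> 0 \<le> g y"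
  shows "(\<lambda>(x, y). f x * g y) summable_on (A \<times> B)"
proof (rule summable_on_SigmaI)
  show "((\<lambda>y. case (x, y) of (x, y) \<Rightarrow> f x * g y) has_sum f x * infsum g B) B" for x
    using has_sum_cmult_right[OF has_sum_infsum[OF g]] by simp
  show "(\<lambda>x. f x * infsum g B) summable_on A"
    by (rule summable_on_cmult_left[OF f])
qed (use f0 g0 in auto)

lemma summable_on_int_inverse_square:
  "(\<lambda>i::int. 1 / (1 + (of_int i)\<^sup>2) :: real) summable_on UNIV"
proof -
  let ?f = "\<lambda>i::int. 1 / (1 + (of_int i)\<^sup>2) :: real"
  have "summable (\<lambda>n::nat. 1 / (1 + (real n)\<^sup>2))"
  proof (rule summable_comparison_test'[of "\<lambda>n. inverse ((real n)\<^sup>2)" 1])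
    show "summable (\<lambda>n. inverse ((real n)\<^sup>2))"
      using inverse_power_summable[of 2, where 'a = real] by simp
  qed (auto simp: inverse_eq_divide intro!: frac_le)
  hence "(\<lambda>n::nat. 1 / (1 + (real n)\<^sup>2)) summable_on UNIV"
    by (intro summable_nonneg_imp_summable_on) auto
  hence n: "(?f \<circ> int) summable_on UNIV" "(?f \<circ> (\<lambda>n. - int n)) summable_on UNIV"
    by (simp_all add: o_def)
  have inj: "inj int" "inj (\<lambda>n. - int n)"
    by (auto simp: inj_def)
  have "?f summable_on (range int \<union> range (\<lambda>n. - int n))"
    using n summable_on_reindex[OF inj(1), of ?f] summable_on_reindex[OF inj(2), of ?f]
    by (intro summable_on_union) auto
  moreover have "range int \<union> range (\<lambda>n. - int n) = UNIV"
    unfolding set_eq_iff by (metis Un_iff UNIV_I int_cases2 rangeI)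
  ultimately show ?thesis by simp
qed

lemma norm_real_freq_ge_1: "k \<noteq> 0 \<Longrightarrow> 1 \<le> norm (real_freq k)"
proof -
  assume "k \<noteq> 0"
  then obtain j where "k $ j \<noteq> 0" by (auto simp: vec_eq_iff)
  hence "1 \<le> \<bar>real_freq k $ j\<bar>" by simp
  also have "\<dots> \<le> norm (real_freq k)" by (rule component_le_norm_cart)
  finally show ?thesis .
qed

text \<open>Each factor \<open>1 + (k $ j)\<^sup>2\<close> is at most twice |k|^2 for
  \<open>k \<noteq> 0\<close>. Three of them give 8 |k|^6, which compares the sum with a product of
  three one-dimensional sums; this is where the exponent 6 comes from. The frequency 0 contributes
  \<open>inverse 0 = 0\<close>.\<close>

lemma summable_on_inverse_norm_6:
  "(\<lambda>k. inverse (norm (real_freq k) ^ 6)) summable_on UNIV"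
proof -
  let ?g = "\<lambda>i::int. 1 / (1 + (of_int i)\<^sup>2) :: real"
  let ?v = "\<lambda>k::int ^ 3. (k $ 1, k $ 2, k $ 3)"
  let ?w = "\<lambda>(a, b, c). vector [a, b, c] :: int ^ 3"
  let ?h = "\<lambda>(a, bc). ?g a * (\<lambda>(b, c). ?g b * ?g c) bc"
  have "?h summable_on (UNIV \<times> (UNIV \<times> UNIV))"
    by (intro summable_on_product_nonneg summable_on_int_inverse_square) auto
  hence "(\<lambda>k. ?h (?v k)) summable_on UNIV"
    by (subst summable_on_reindex_bij_witness[of UNIV ?w ?v UNIV ?h])
      (auto simp: vec_eq_iff forall_3 vector_3)
  hence s: "(\<lambda>k. 8 * ?h (?v k)) summable_on UNIV"
    by (rule summable_on_cmult_right)
  show ?thesis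
  proof (rule summable_on_nonneg_comparison[OF s])
    fix k :: "int ^ 3"
    show "inverse (norm (real_freq k) ^ 6) \<le> 8 * ?h (?v k)"
    proof (cases "k = 0")
      case False
      let ?r = "(norm (real_freq k))\<^sup>2"
      have r1: "1 \<le> ?r"
        using norm_real_freq_ge_1[OF False] by (simp add: one_le_power)
      have c: "1 + (of_int (k $ j))\<^sup>2 \<le> 2 * ?r" for j
      proof -
        have "\<bar>real_freq k $ j\<bar>\<^sup>2 \<le> ?r"
          by (intro power_mono component_le_norm_cart) simp
        hence "(of_int (k $ j))\<^sup>2 \<le> ?r" by (simp only: power2_abs real_freq_simps)
        thus ?thesis using r1 by linarith
      qed
      have "(1 + (of_int (k $ 1))\<^sup>2) * ((1 + (of_int (k $ 2))\<^sup>2) * (1 + (of_int (k $ 3))\<^sup>2))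
          \<le> (2 * ?r) * ((2 * ?r) * (2 * ?r))"
        by (intro mult_mono c mult_nonneg_nonneg) auto
      also have "\<dots> = 8 * norm (real_freq k) ^ 6"
        by (simp add: power_mult_distrib eval_nat_numeral)
      finally have le: "(1 + (of_int (k $ 1))\<^sup>2) * ((1 + (of_int (k $ 2))\<^sup>2) * (1 + (of_int (k $ 3))\<^sup>2))
          \<le> 8 * norm (real_freq k) ^ 6" .
      have pos: "0 < (1 + (of_int (k $ 1))\<^sup>2) * ((1 + (of_int (k $ 2))\<^sup>2) * (1 + (of_int (k $ 3))\<^sup>2) :: real)"
        by (intro mult_pos_pos) (auto intro: add_pos_nonneg)
      have "inverse (8 * norm (real_freq k) ^ 6)
          \<le> inverse ((1 + (of_int (k $ 1))\<^sup>2) * ((1 + (of_int (k $ 2))\<^sup>2) * (1 + (of_int (k $ 3))\<^sup>2)))"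
        by (rule le_imp_inverse_le[OF le pos])
      moreover have "inverse (norm (real_freq k) ^ 6) = 8 * inverse (8 * norm (real_freq k) ^ 6)"
        by simp
      moreover have "?h (?v k) = inverse ((1 + (of_int (k $ 1))\<^sup>2) * ((1 + (of_int (k $ 2))\<^sup>2) * (1 + (of_int (k $ 3))\<^sup>2)))"
        by (simp add: divide_inverse)
      ultimately show ?thesis by linarith
    qed simp
  qed auto
qed

text \<open>By the arithmetic-geometric mean inequality the product \<open>X k * X p\<close> is at
  most half the sum of the squares; after the substitution l = k - p each half is a product of two
  independent sums. It is Young's inequality for a convolution of l2 with l1, tested against
  l2.\<close>

lemma trilinear_sum:
  fixes X Z :: "int ^ 3 \<Rightarrow> real"
  assumes X: "(\<lambda>k. (X k)\<^sup>2) summable_on UNIV" and Z: "Z summable_on UNIV"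
    and X0: "\<And>k. 0 \<le> X k" and Z0: "\<And>k. 0 \<le> Z k"
  shows "(\<lambda>(k, p). X k * X p * Z (k - p)) summable_on UNIV"
    and "(\<Sum>\<^sub>\<infinity>(k, p). X k * X p * Z (k - p)) \<le> (\<Sum>\<^sub>\<infinity>k. (X k)\<^sup>2) * (\<Sum>\<^sub>\<infinity>k. Z k)"
proof -
  let ?a = "\<lambda>(k, l). (X k)\<^sup>2 * Z l"
  have s: "?a summable_on UNIV"
    using summable_on_product_nonneg[OF X Z] Z0 by simp
  have "infsum ?a (UNIV \<times> UNIV) = (\<Sum>\<^sub>\<infinity>k. \<Sum>\<^sub>\<infinity>l. ?a (k, l))"
    by (rule infsum_Sigma_banach[symmetric]) (use s in simp)
  also have "\<dots> = (\<Sum>\<^sub>\<infinity>k. (X k)\<^sup>2) * (\<Sum>\<^sub>\<infinity>k. Z k)"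
    using X Z by (simp add: infsum_cmult_right infsum_cmult_left)
  finally have I: "infsum ?a UNIV = (\<Sum>\<^sub>\<infinity>k. (X k)\<^sup>2) * (\<Sum>\<^sub>\<infinity>k. Z k)" by simp
  have 1: "(\<lambda>(k, p). (X k)\<^sup>2 * Z (k - p)) summable_on UNIV \<longleftrightarrow> ?a summable_on UNIV"
    by (rule summable_on_reindex_bij_witness[of _ "\<lambda>(k, l). (k, k - l)" "\<lambda>(k, p). (k, k - p)"]) auto
  have 2: "(\<lambda>(k, p). (X p)\<^sup>2 * Z (k - p)) summable_on UNIV \<longleftrightarrow> ?a summable_on UNIV"
    by (rule summable_on_reindex_bij_witness[of _ "\<lambda>(p, l). (l + p, p)" "\<lambda>(k, p). (p, k - p)"]) auto
  have 3: "(\<Sum>\<^sub>\<infinity>(k, p). (X k)\<^sup>2 * Z (k - p)) = infsum ?a UNIV"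
    by (rule infsum_reindex_bij_witness[of _ "\<lambda>(k, l). (k, k - l)" "\<lambda>(k, p). (k, k - p)"]) auto
  have 4: "(\<Sum>\<^sub>\<infinity>(k, p). (X p)\<^sup>2 * Z (k - p)) = infsum ?a UNIV"
    by (rule infsum_reindex_bij_witness[of _ "\<lambda>(p, l). (l + p, p)" "\<lambda>(k, p). (p, k - p)"]) auto
  let ?b = "\<lambda>kp. ((\<lambda>(k, p). (X k)\<^sup>2 * Z (k - p)) kp + (\<lambda>(k, p). (X p)\<^sup>2 * Z (k - p)) kp) / 2"
  let ?b1 = "\<lambda>(k, p). (X k)\<^sup>2 * Z (k - p)" and ?b2 = "\<lambda>(k, p). (X p)\<^sup>2 * Z (k - p)"
  have s1: "?b1 summable_on UNIV" and s2: "?b2 summable_on UNIV"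
    using s 1 2 by blast+
  have "(?b has_sum (infsum ?a UNIV + infsum ?a UNIV) / 2) UNIV"
    using has_sum_cmult_left[OF has_sum_add[OF has_sum_infsum[OF s1] has_sum_infsum[OF s2]], of "1/2"]
    unfolding 3 4 by simp
  hence sb: "?b summable_on UNIV" and ib: "infsum ?b UNIV = infsum ?a UNIV"
    by (simp_all only: has_sum_iff field_sum_of_halves add_divide_distrib)
  have le: "(\<lambda>(k, p). X k * X p * Z (k - p)) kp \<le> ?b kp" for kp
  proof -
    obtain k p where kp: "kp = (k, p)" by fastforce
    have "X k * X p \<le> ((X k)\<^sup>2 + (X p)\<^sup>2) / 2"
      using sum_squares_bound[of "X k" "X p"] by simp
    from mult_right_mono[OF this Z0[of "k - p"]] show ?thesis
      by (simp add: kp field_simps)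
  qed
  show S: "(\<lambda>(k, p). X k * X p * Z (k - p)) summable_on UNIV"
    by (rule summable_on_nonneg_comparison[OF sb]) (use X0 Z0 le in auto)
  show "(\<Sum>\<^sub>\<infinity>(k, p). X k * X p * Z (k - p)) \<le> (\<Sum>\<^sub>\<infinity>k. (X k)\<^sup>2) * (\<Sum>\<^sub>\<infinity>k. Z k)"
    using infsum_mono[OF S sb le] by (simp add: ib I)
qed

text \<open>Same sum after the substitution p -> k - p: here the summable factor sits at
  \<open>p\<close> and a square-summable one at \<open>k - p\<close>.\<close>

lemma trilinear_sum':
  fixes X Z :: "int ^ 3 \<Rightarrow> real"
  assumes X: "(\<lambda>k. (X k)\<^sup>2) summable_on UNIV" and Z: "Z summable_on UNIV"
    and X0: "\<And>k. 0 \<le> X k" and Z0: "\<And>k. 0 \<le> Z k"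
  shows "(\<lambda>(k, p). X k * X (k - p) * Z p) summable_on UNIV"
    and "(\<Sum>\<^sub>\<infinity>(k, p). X k * X (k - p) * Z p) \<le> (\<Sum>\<^sub>\<infinity>k. (X k)\<^sup>2) * (\<Sum>\<^sub>\<infinity>k. Z k)"
proof -
  let ?b = "\<lambda>(k, p). X k * X p * Z (k - p)"
  have 1: "(\<lambda>(k, p). X k * X (k - p) * Z p) summable_on UNIV \<longleftrightarrow> ?b summable_on UNIV"
    by (rule summable_on_reindex_bij_witness[of _ "\<lambda>(k, p). (k, k - p)" "\<lambda>(k, p). (k, k - p)"]) auto
  have 2: "(\<Sum>\<^sub>\<infinity>(k, p). X k * X (k - p) * Z p) = infsum ?b UNIV"
    by (rule infsum_reindex_bij_witness[of _ "\<lambda>(k, p). (k, k - p)" "\<lambda>(k, p). (k, k - p)"]) auto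
  show "(\<lambda>(k, p). X k * X (k - p) * Z p) summable_on UNIV"
    using trilinear_sum(1)[OF assms] 1 by simp
  show "(\<Sum>\<^sub>\<infinity>(k, p). X k * X (k - p) * Z p) \<le> (\<Sum>\<^sub>\<infinity>k. (X k)\<^sup>2) * (\<Sum>\<^sub>\<infinity>k. Z k)"
    using trilinear_sum(2)[OF assms] 2 by simp
qed

section \<open>Commutator of the weight with transport\<close>

lemma power_diff_le:
  fixes a b :: real
  assumes "0 \<le> a" "0 \<le> b" "a \<le> M" "b \<le> M"
  shows "\<bar>a ^ n - b ^ n\<bar> \<le> real n * \<bar>a - b\<bar> * M ^ (n - 1)"
proof -
  have eq: "\<bar>a ^ n - b ^ n\<bar> = \<bar>a - b\<bar> * \<bar>\<Sum>i<n. a ^ i * b ^ (n - Suc i)\<bar>"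
    by (simp add: power_diff_sumr2 abs_mult mult.commute)
  have "\<bar>\<Sum>i<n. a ^ i * b ^ (n - Suc i)\<bar> \<le> (\<Sum>i<n. M ^ (n - 1))"
  proof (rule order_trans[OF sum_abs sum_mono])
    fix i assume i: "i \<in> {..<n}"
    have "\<bar>a ^ i * b ^ (n - Suc i)\<bar> \<le> M ^ i * M ^ (n - Suc i)"
      using assms by (auto simp: abs_mult intro!: mult_mono power_mono)
    also have "\<dots> = M ^ (n - 1)" using i by (simp flip: power_add)
    finally show "\<bar>a ^ i * b ^ (n - Suc i)\<bar> \<le> M ^ (n - 1)" .
  qed
  from mult_left_mono[OF this, of "\<bar>a - b\<bar>"] eq show ?thesis by (simp add: mult_ac)
qed

lemma power_add_le:
  fixes a b :: real
  assumes "0 \<le> a" "0 \<le> b"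
  shows "(a + b) ^ n \<le> 2 ^ n * (a ^ n + b ^ n)"
proof -
  have "(a + b) ^ n \<le> (2 * max a b) ^ n"
    using assms by (intro power_mono) auto
  also have "\<dots> = 2 ^ n * (max a b) ^ n" by (simp add: power_mult_distrib)
  also have "(max a b) ^ n \<le> a ^ n + b ^ n"
    using assms by (auto simp: max_def)
  finally show ?thesis by (simp add: mult_left_mono)
qed

text \<open>A Kato-Ponce estimate on the lattice. The difference of the weights gains a factor |k -
  p| and loses one power, and the spare factor |p| is then distributed so that neither frequency
  receives more than n powers.\<close>

lemma commutator_bound:
  assumes n: "n \<ge> 1"
  shows "\<bar>norm (real_freq k) ^ n - norm (real_freq p) ^ n\<bar> * norm (real_freq p) \<le>
      real n * 2 ^ n * (norm (real_freq (k - p)) ^ n * norm (real_freq p)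
        + norm (real_freq (k - p)) * norm (real_freq p) ^ n)"
proof -
  let ?k = "norm (real_freq k)" and ?p = "norm (real_freq p)" and ?l = "norm (real_freq (k - p))"
  have kl: "?k \<le> ?l + ?p"
    using norm_triangle_ineq[of "real_freq (k - p)" "real_freq p"] by simp
  have d: "\<bar>?k - ?p\<bar> \<le> ?l"
    using norm_triangle_ineq3[of "real_freq k" "real_freq p"] by simp
  have "\<bar>?k ^ n - ?p ^ n\<bar> \<le> real n * \<bar>?k - ?p\<bar> * (?l + ?p) ^ (n - 1)"
    by (rule power_diff_le) (use kl in auto)
  also have "\<dots> \<le> real n * ?l * (2 ^ (n - 1) * (?l ^ (n - 1) + ?p ^ (n - 1)))"
    by (intro mult_mono mult_left_mono d power_add_le) auto
  also have "\<dots> \<le> real n * ?l * (2 ^ n * (?l ^ (n - 1) + ?p ^ (n - 1)))"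
    by (intro mult_left_mono mult_right_mono power_increasing) auto
  finally have "\<bar>?k ^ n - ?p ^ n\<bar> * ?p \<le> real n * ?l * (2 ^ n * (?l ^ (n - 1) + ?p ^ (n - 1))) * ?p"
    by (rule mult_right_mono) simp
  also have "\<dots> = real n * 2 ^ n * ((?l * ?l ^ (n - 1)) * ?p + ?l * (?p * ?p ^ (n - 1)))"
    by (simp add: algebra_simps)
  also have "\<dots> = real n * 2 ^ n * (?l ^ n * ?p + ?l * ?p ^ n)"
    using n by (simp flip: power_Suc)
  finally show ?thesis .
qed

section \<open>Energy estimate for the nonlinear term\<close>

text \<open>At \<open>k = 0\<close> and positive \<open>N\<close> the right-hand side is 0, since
  \<open>inverse 0 = 0\<close>. The predicate thus also encodes zero mean.\<close>

definition rapid :: "(int ^ 3 \<Rightarrow> complex) \<Rightarrow> bool" where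
  "rapid c \<longleftrightarrow> (\<forall>N. \<exists>C. \<forall>k. norm (c k) \<le> C * inverse (norm (real_freq k) ^ N))"

lemma rapid_zero: "rapid c \<Longrightarrow> c 0 = 0"
  unfolding rapid_def by (metis inverse_zero mult_zero_right norm_le_zero_iff norm_zero power_Suc
      mult_zero_left real_freq_simps(1))

text \<open>Nonzero lattice points have norm at least 1. The condition at frequency 0 is there for
  \<open>i = 0\<close>, where the left weight is \<open>0 ^ 0 = 1\<close>.\<close>

lemma weight_mono: "i \<le> j \<Longrightarrow> c 0 = 0 \<Longrightarrow>
    norm (real_freq k) ^ i * norm (c k) \<le> norm (real_freq k) ^ j * norm (c k)"
  using norm_real_freq_ge_1[of k] by (cases "k = 0") (auto intro!: mult_right_mono power_increasing)

lemma rapidE: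
  assumes "rapid c"
  obtains C where "0 \<le> C" "\<And>k. norm (c k) \<le> C * inverse (norm (real_freq k) ^ N)"
proof -
  obtain C where C: "\<And>k. norm (c k) \<le> C * inverse (norm (real_freq k) ^ N)"
    using assms unfolding rapid_def by blast
  have "norm (c k) \<le> \<bar>C\<bar> * inverse (norm (real_freq k) ^ N)" for k
    by (rule order_trans[OF C]) (intro mult_right_mono, auto)
  thus ?thesis by (intro that[of "\<bar>C\<bar>"]) auto
qed

lemma decay_weighted:
  assumes "0 \<le> C" and "norm (c k) \<le> C * inverse (norm (real_freq k) ^ (j + i))"
  shows "norm (real_freq k) ^ j * norm (c k) \<le> C * inverse (norm (real_freq k) ^ i)"
proof (cases "k = 0")
  case True
  thus ?thesis using assms by (cases "i = 0"; cases "j = 0") (auto simp: power_0_left)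
next
  case False
  hence pos: "0 < norm (real_freq k)" by simp
  have "norm (real_freq k) ^ j * norm (c k) \<le> norm (real_freq k) ^ j * (C * inverse (norm (real_freq k) ^ (j + i)))"
    by (intro mult_left_mono assms) auto
  also have "\<dots> = C * inverse (norm (real_freq k) ^ i)"
    using pos by (simp add: power_add field_simps)
  finally show ?thesis .
qed

lemma rapid_summable:
  assumes "rapid c"
  shows "(\<lambda>k. norm (real_freq k) ^ j * norm (c k)) summable_on UNIV"
proof -
  obtain C where C: "0 \<le> C" "\<And>k. norm (c k) \<le> C * inverse (norm (real_freq k) ^ (j + 6))"
    using rapidE[OF assms] by blast
  show ?thesis
    by (rule summable_on_nonneg_comparison[OF summable_on_cmult_right[OF summable_on_inverse_norm_6, of C]])
      (auto intro!: decay_weighted[OF C])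
qed

lemma rapid_square_summable:
  assumes "rapid c"
  shows "(\<lambda>k. (norm (real_freq k) ^ j * norm (c k))\<^sup>2) summable_on UNIV"
proof -
  obtain C where C: "\<And>k. norm (c k) \<le> C * inverse (norm (real_freq k) ^ 0)"
    using assms unfolding rapid_def by blast
  show ?thesis
  proof (rule summable_on_nonneg_comparison[OF summable_on_cmult_left[OF rapid_summable[OF assms, of "2 * j"], of C]])
    fix k
    have "(norm (real_freq k) ^ j * norm (c k))\<^sup>2 = norm (real_freq k) ^ (2 * j) * norm (c k) * norm (c k)"
      by (simp add: power2_eq_square power_mult power_mult_distrib mult_ac)
    also have "\<dots> \<le> norm (real_freq k) ^ (2 * j) * norm (c k) * C"
      using C[of k] by (intro mult_left_mono) auto
    finally show "(norm (real_freq k) ^ j * norm (c k))\<^sup>2 \<le> norm (real_freq k) ^ (2 * j) * norm (c k) * C" .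
  qed auto
qed

section \<open>Transport by a bounded, even, divergence free symbol\<close>

definition div_free_symbol :: "real \<Rightarrow> (int ^ 3 \<Rightarrow> real ^ 3) \<Rightarrow> bool" where
  "div_free_symbol M m \<longleftrightarrow>
     (\<forall>l. norm (m l) \<le> M) \<and> (\<forall>l. m (- l) = m l) \<and> (\<forall>l. m l \<bullet> real_freq l = 0)"

text \<open>The symbol at \<open>k - p\<close> is orthogonal to \<open>k - p\<close>. Hence the
  derivative in the transport term may be read at the output frequency \<open>k\<close> or at the
  transported frequency \<open>p\<close>, whichever is convenient.\<close>

lemma div_free_symbol_shift:
  "div_free_symbol M m \<Longrightarrow> m (k - p) \<bullet> real_freq k = m (k - p) \<bullet> real_freq p"
  unfolding div_free_symbol_def using inner_diff_right[of "m (k - p)" "real_freq k" "real_freq p"]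
  by (metis real_freq_simps(2) eq_iff_diff_eq_0)

lemma div_free_symbol_bound:
  assumes "div_free_symbol M m"
  shows "\<bar>m (k - p) \<bullet> real_freq k\<bar> \<le> M * norm (real_freq p)"
proof -
  have "\<bar>m (k - p) \<bullet> real_freq k\<bar> \<le> norm (m (k - p)) * norm (real_freq p)"
    by (subst div_free_symbol_shift[OF assms]) (rule Cauchy_Schwarz_ineq2)
  also have "\<dots> \<le> M * norm (real_freq p)"
    using assms by (intro mult_right_mono) (auto simp: div_free_symbol_def)
  finally show ?thesis .
qed

text \<open>Fourier form of the vanishing of the integral of (u . grad \<psi>) \<psi>. Exchanging
  \<open>k\<close> and \<open>p\<close> turns each term into minus its conjugate: the symbol is
  even, \<open>a\<close> belongs to a real function, and the derivative may be moved from
  \<open>k\<close> to \<open>p\<close>. The sum is therefore purely imaginary.\<close>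

lemma transport_antisymmetric:
  assumes m: "div_free_symbol M m" and a: "rapid a" "\<And>k. a (- k) = cnj (a k)" and \<psi>: "rapid \<psi>"
  defines "T \<equiv> \<lambda>(k :: int ^ 3, p :: int ^ 3). \<i> * of_real (m (k - p) \<bullet> real_freq k) * a (k - p) * cnj (\<psi> k) * \<psi> p"
  shows "T summable_on UNIV" and "Re (\<Sum>\<^sub>\<infinity>kp. T kp) = 0"
proof -
  let ?X = "\<lambda>k. norm (real_freq k) ^ 1 * norm (\<psi> k)" and ?Z = "\<lambda>k. norm (real_freq k) ^ 0 * norm (a k)"
  have M: "0 \<le> M"
    using m norm_ge_zero[of "m 0"] unfolding div_free_symbol_def by (meson order_trans)
  have G: "(\<lambda>(k, p). ?X k * ?X p * ?Z (k - p)) summable_on UNIV"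
    by (rule trilinear_sum(1)[OF rapid_square_summable[OF \<psi>] rapid_summable[OF a(1)]]) auto
  have "(\<lambda>kp. norm (T kp)) summable_on UNIV"
  proof (rule summable_on_nonneg_comparison[OF summable_on_cmult_right[OF G, of M]])
    fix kp :: "(int ^ 3) \<times> (int ^ 3)"
    obtain k p where kp: "kp = (k, p)" by fastforce
    have "norm (T kp) = \<bar>m (k - p) \<bullet> real_freq k\<bar> * norm (a (k - p)) * norm (\<psi> k) * norm (\<psi> p)"
      by (simp add: T_def kp norm_mult)
    also have "\<dots> \<le> (M * norm (real_freq p)) * norm (a (k - p)) * norm (\<psi> k) * norm (\<psi> p)"
      by (intro mult_right_mono div_free_symbol_bound[OF m]) auto
    also have "\<dots> = M * norm (a (k - p)) * ?X p * norm (\<psi> k)"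
      by (simp add: mult_ac)
    also have "\<dots> \<le> M * norm (a (k - p)) * ?X p * ?X k"
      using weight_mono[of 0 1 \<psi> k] rapid_zero[OF \<psi>] M by (intro mult_left_mono) auto
    finally show "norm (T kp) \<le> M * (\<lambda>(k, p). ?X k * ?X p * ?Z (k - p)) kp"
      by (simp add: kp mult_ac)
  qed auto
  thus "T summable_on UNIV" by (rule abs_summable_summable)
  have cT: "cnj (T (k, p)) = - T (p, k)" for k p
  proof -
    have "cnj (a (k - p)) = a (p - k)" "m (p - k) = m (k - p)"
      using a(2)[of "k - p"] m unfolding div_free_symbol_def by (metis minus_diff_eq)+
    thus ?thesis
      using div_free_symbol_shift[OF m, of k p] by (simp add: T_def mult_ac)
  qed
  have "cnj (\<Sum>\<^sub>\<infinity>kp. T kp) = (\<Sum>\<^sub>\<infinity>kp. cnj (T kp))" by simp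
  also have "\<dots> = (\<Sum>\<^sub>\<infinity>kp. - T kp)"
    by (rule infsum_reindex_bij_witness[of _ prod.swap prod.swap]) (auto simp: cT)
  also have "\<dots> = - (\<Sum>\<^sub>\<infinity>kp. T kp)" by (rule infsum_uminus)
  finally show "Re (\<Sum>\<^sub>\<infinity>kp. T kp) = 0"
    by (simp add: complex_eq_iff)
qed

text \<open>The squared homogeneous Sobolev norm of order \<open>n\<close>, up to the volume factor
  of Parseval's identity.\<close>

definition sobolev_energy :: "nat \<Rightarrow> (int ^ 3 \<Rightarrow> complex) \<Rightarrow> real" where
  "sobolev_energy n c = (\<Sum>\<^sub>\<infinity>k. (norm (real_freq k) ^ n * norm (c k))\<^sup>2)"

lemma sobolev_energy_nonneg: "0 \<le> sobolev_energy n c"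
  unfolding sobolev_energy_def by (rule infsum_nonneg) simp

lemma le_sqrt_sobolev_energy:
  assumes "rapid c"
  shows "norm (real_freq k) ^ n * norm (c k) \<le> sqrt (sobolev_energy n c)"
proof (rule real_le_rsqrt)
  show "(norm (real_freq k) ^ n * norm (c k))\<^sup>2 \<le> sobolev_energy n c"
    using finite_sum_le_infsum[OF rapid_square_summable[OF assms, of n], of "{k}"]
    unfolding sobolev_energy_def by simp
qed

text \<open>The weight \<open>|k|\<^sup>n\<close> is moved past the transport operator; the part in which it is moved is
  antisymmetric and the rest is a commutator that costs no derivative of \<open>c\<close> beyond the \<open>n\<close>-th.\<close>

lemma nonlinear_energy_bound:
  assumes m: "div_free_symbol M m" and n: "n \<ge> 7"
    and c: "rapid c" "\<And>k. c (- k) = cnj (c k)" and b: "rapid b" "\<And>k. b (- k) = cnj (b k)"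
  defines "w \<equiv> \<lambda>k. norm (real_freq k) ^ n"
  defines "Q \<equiv> \<lambda>(k :: int ^ 3, p :: int ^ 3). of_real ((w k)\<^sup>2) * cnj (c k) * (\<i> * of_real (m (k - p) \<bullet> real_freq p) *
      ((c (k - p) + b (k - p)) * c p + c (k - p) * b p))"
  shows "Q summable_on UNIV"
    and "\<bar>Re (\<Sum>\<^sub>\<infinity>kp. Q kp)\<bar> \<le> M * 2 ^ n * (4 * real n + 4) * sobolev_energy n c *
      (sqrt (sobolev_energy n c) * (\<Sum>\<^sub>\<infinity>k. inverse (norm (real_freq k) ^ 6))
        + (\<Sum>\<^sub>\<infinity>k. norm (real_freq k) ^ (n + 1) * norm (b k)))"
proof -
  define X where "X = (\<lambda>k. w k * norm (c k))"
  \<comment> \<open>\<open>X\<close> is the factor measured in l2 and \<open>Z\<close> the one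
    measured in l1. \<open>Z\<close> allows one derivative on \<open>c\<close>, which the energy can
    pay for, and \<open>n + 1\<close> on \<open>b\<close>, which is a fixed function.\<close>
  define Z where "Z = (\<lambda>k. norm (real_freq k) * norm (c k) + norm (real_freq k) ^ (n + 1) * norm (b k))"
  define \<psi> where "\<psi> = (\<lambda>k. of_real (w k) * c k)"
  define a where "a = (\<lambda>k. c k + b k)"
  \<comment> \<open>One of the two weights \<open>w k\<close> is replaced by \<open>w p\<close>, so
    that the same weighted sequence \<open>\<psi>\<close> stands in both places.\<close>
  define T where "T = (\<lambda>(k :: int ^ 3, p :: int ^ 3). \<i> * of_real (m (k - p) \<bullet> real_freq k) * a (k - p) * cnj (\<psi> k) * \<psi> p)"
  define R where "R = (\<lambda>kp. Q kp - T kp)"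
  define G where "G = (\<lambda>(k, p). X k * X p * Z (k - p))"
  define G' where "G' = (\<lambda>(k, p). X k * X (k - p) * Z p)"
  define C where "C = M * 2 ^ n * (2 * real n + 2)"
  have M: "0 \<le> M"
    using m norm_ge_zero[of "m 0"] unfolding div_free_symbol_def by (meson order_trans)
  have w0: "0 \<le> w k" for k by (simp add: w_def)
  have X0: "0 \<le> X k" and Z0: "0 \<le> Z k" for k
    by (simp_all add: X_def Z_def w_def)
  have X2: "(\<lambda>k. (X k)\<^sup>2) summable_on UNIV" and gX: "(\<Sum>\<^sub>\<infinity>k. (X k)\<^sup>2) = sobolev_energy n c"
    using rapid_square_summable[OF c(1), of n] by (simp_all add: X_def w_def sobolev_energy_def)
  have Zs: "Z summable_on UNIV"
    unfolding Z_def using rapid_summable[OF c(1), of 1] rapid_summable[OF b(1), of "n + 1"]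
    by (intro summable_on_add) simp_all
  have ZI: "(\<Sum>\<^sub>\<infinity>k. Z k) \<le> sqrt (sobolev_energy n c) * (\<Sum>\<^sub>\<infinity>k. inverse (norm (real_freq k) ^ 6))
        + (\<Sum>\<^sub>\<infinity>k. norm (real_freq k) ^ (n + 1) * norm (b k))"
  proof -
    \<comment> \<open>Here \<open>n \<ge> 7\<close> enters: seven weights are one derivative and six
      powers for the convergence of the lattice sum.\<close>
    have le: "norm (real_freq k) ^ 1 * norm (c k) \<le> sqrt (sobolev_energy n c) * inverse (norm (real_freq k) ^ 6)" for k
    proof (cases "k = 0")
      case False
      hence pos: "0 < norm (real_freq k)" by simp
      have "norm (real_freq k) ^ 7 * norm (c k) \<le> sqrt (sobolev_energy n c)"
        using weight_mono[OF n, of c k] rapid_zero[OF c(1)] le_sqrt_sobolev_energy[OF c(1), of k n] by linarith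
      moreover have "norm (real_freq k) ^ 7 = norm (real_freq k) ^ 6 * norm (real_freq k)"
        by (simp add: eval_nat_numeral)
      ultimately show ?thesis
        using pos by (simp add: field_simps)
    qed (use rapid_zero[OF c(1)] in simp)
    have "(\<Sum>\<^sub>\<infinity>k. Z k) = (\<Sum>\<^sub>\<infinity>k. norm (real_freq k) ^ 1 * norm (c k))
        + (\<Sum>\<^sub>\<infinity>k. norm (real_freq k) ^ (n + 1) * norm (b k))"
      unfolding Z_def using rapid_summable[OF c(1), of 1] rapid_summable[OF b(1), of "n + 1"]
      by (subst infsum_add) simp_all
    also have "(\<Sum>\<^sub>\<infinity>k. norm (real_freq k) ^ 1 * norm (c k))
        \<le> (\<Sum>\<^sub>\<infinity>k. sqrt (sobolev_energy n c) * inverse (norm (real_freq k) ^ 6))"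
      by (intro infsum_mono rapid_summable c summable_on_cmult_right summable_on_inverse_norm_6 le)
    finally show ?thesis
      by (simp add: infsum_cmult_right summable_on_inverse_norm_6)
  qed
  have Gs: "G summable_on UNIV" "infsum G UNIV \<le> sobolev_energy n c * (\<Sum>\<^sub>\<infinity>k. Z k)"
    using trilinear_sum[OF X2 Zs X0 Z0] by (simp_all add: G_def gX)
  have Gs': "G' summable_on UNIV" "infsum G' UNIV \<le> sobolev_energy n c * (\<Sum>\<^sub>\<infinity>k. Z k)"
    using trilinear_sum'[OF X2 Zs X0 Z0] by (simp_all add: G'_def gX)
  have Rle: "norm (R kp) \<le> C * (G kp + G' kp)" for kp
  proof -
    obtain k p where kp: "kp = (k, p)" by fastforce
    define l where "l = k - p"
    let ?k = "norm (real_freq k)" and ?l = "norm (real_freq l)" and ?p = "norm (real_freq p)"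
    let ?m = "m l \<bullet> real_freq k"
    \<comment> \<open>Without \<open>T\<close> there remain the commutator \<open>w k - w p\<close>
      and the velocity of \<open>c\<close> acting on \<open>b\<close>, which keeps its full
      weight.\<close>
    have "R kp = of_real (w k) * cnj (c k) * (\<i> * of_real ?m) *
        (a l * of_real (w k - w p) * c p + of_real (w k) * c l * b p)"
      using div_free_symbol_shift[OF m, of k p]
      by (simp add: R_def Q_def T_def kp \<psi>_def a_def l_def power2_eq_square algebra_simps)
    hence "norm (R kp) = X k * \<bar>?m\<bar> * norm (a l * of_real (w k - w p) * c p + of_real (w k) * c l * b p)"
      using w0[of k] by (simp add: norm_mult X_def)
    also have "\<dots> \<le> X k * (M * ?p) * (norm (a l) * \<bar>w k - w p\<bar> * norm (c p) + w k * norm (c l) * norm (b p))"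
      using w0[of k] X0[of k] div_free_symbol_bound[OF m, of k p] M
      by (intro mult_mono order_trans[OF norm_triangle_ineq])
        (auto simp: norm_mult l_def intro!: mult_nonneg_nonneg simp flip: of_real_diff)
    also have "\<dots> = M * X k * ((\<bar>w k - w p\<bar> * ?p) * (norm (a l) * norm (c p)) + w k * ?p * norm (c l) * norm (b p))"
      by (simp add: algebra_simps)
    also have "\<dots> \<le> M * X k * ((real n * 2 ^ n) * (X l * Z p + 2 * (Z l * X p)) + 2 ^ n * (2 * (X l * Z p)))"
    proof (rule mult_left_mono[OF add_mono])
      have b1: "?l ^ n * norm (b l) \<le> ?l ^ (n + 1) * norm (b l)" "?l ^ 1 * norm (b l) \<le> ?l ^ (n + 1) * norm (b l)"
        by (intro weight_mono rapid_zero b; simp)+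
      have b2: "?p ^ 1 * norm (b p) \<le> ?p ^ (n + 1) * norm (b p)"
        by (intro weight_mono rapid_zero b; simp)
      have c1: "?p ^ 1 * norm (c p) \<le> X p" "?l ^ 0 * norm (c l) \<le> X l"
        unfolding X_def w_def using n by (intro weight_mono rapid_zero c; simp)+
      have "(\<bar>w k - w p\<bar> * ?p) * (norm (a l) * norm (c p))
          \<le> (real n * 2 ^ n * (?l ^ n * ?p + ?l * ?p ^ n)) * (norm (a l) * norm (c p))"
        unfolding w_def l_def using n by (intro mult_right_mono commutator_bound) auto
      also have "\<dots> \<le> (real n * 2 ^ n * (?l ^ n * ?p + ?l * ?p ^ n)) * ((norm (c l) + norm (b l)) * norm (c p))"
        unfolding a_def by (intro mult_left_mono mult_right_mono norm_triangle_ineq) auto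
      \<comment> \<open>In each product one factor is \<open>c\<close> with at most \<open>n\<close>
        derivatives and goes to \<open>X\<close>; the other has a single derivative of
        \<open>c\<close> or at most \<open>n\<close> of \<open>b\<close> and goes to
        \<open>Z\<close>.\<close>
      also have "\<dots> = real n * 2 ^ n * ((?l ^ n * norm (c l)) * (?p * norm (c p)) + (?l ^ n * norm (b l)) * (?p * norm (c p))
          + (?l * norm (c l) + ?l * norm (b l)) * (?p ^ n * norm (c p)))"
        by (simp add: algebra_simps)
      also have "\<dots> \<le> real n * 2 ^ n * (X l * Z p + Z l * X p + Z l * X p)"
      proof (intro mult_left_mono add_mono mult_mono)
        show "?l ^ n * norm (b l) \<le> Z l" using b1(1) by (simp add: Z_def add_increasing)
        show "?l * norm (c l) + ?l * norm (b l) \<le> Z l" using b1(2) by (simp add: Z_def)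
        show "?p * norm (c p) \<le> X p" using c1 by simp
      qed (auto simp: X_def w_def Z_def)
      finally show "(\<bar>w k - w p\<bar> * ?p) * (norm (a l) * norm (c p)) \<le> (real n * 2 ^ n) * (X l * Z p + 2 * (Z l * X p))"
        by (simp only: mult_2 add.assoc)
      \<comment> \<open>The weight at \<open>k\<close> is split between the two frequencies. When it
        falls on \<open>b\<close>, the derivative already there makes \<open>n + 1\<close>.\<close>
      have "?k ^ n \<le> (?l + ?p) ^ n"
        using norm_triangle_ineq[of "real_freq (k - p)" "real_freq p"] by (intro power_mono) (auto simp: l_def)
      also have "\<dots> \<le> 2 ^ n * (?l ^ n + ?p ^ n)"
        by (rule power_add_le) auto
      finally have "w k * (?p * norm (c l) * norm (b p)) \<le> 2 ^ n * (?l ^ n + ?p ^ n) * (?p * norm (c l) * norm (b p))"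
        unfolding w_def by (rule mult_right_mono) auto
      also have "\<dots> = 2 ^ n * ((?l ^ n * norm (c l)) * (?p * norm (b p)) + norm (c l) * (?p ^ (n + 1) * norm (b p)))"
        by (simp add: algebra_simps)
      also have "\<dots> \<le> 2 ^ n * (X l * Z p + X l * Z p)"
      proof (intro mult_left_mono add_mono mult_mono)
        show "?p * norm (b p) \<le> Z p" using b2 by (simp add: Z_def add_increasing)
        show "norm (c l) \<le> X l" using c1 by simp
        show "?p ^ (n + 1) * norm (b p) \<le> Z p" by (simp add: Z_def)
      qed (auto simp: X_def w_def Z_def)
      finally show "w k * ?p * norm (c l) * norm (b p) \<le> 2 ^ n * (2 * (X l * Z p))"
        by (simp add: mult_ac)
      show "0 \<le> M * X k" using M X0 by simp
    qed
    also have "\<dots> = M * 2 ^ n * ((real n + 2) * (X k * X l * Z p) + (2 * real n) * (X k * X p * Z l))"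
      by (simp add: algebra_simps)
    \<comment> \<open>The constant \<open>2 * real n + 2\<close> dominates both
      \<open>real n + 2\<close> and \<open>2 * real n\<close>; summing \<open>G\<close> and
      \<open>G'\<close> doubles it to \<open>4 * real n + 4\<close>.\<close>
    also have "\<dots> \<le> M * 2 ^ n * ((2 * real n + 2) * (X k * X l * Z p) + (2 * real n + 2) * (X k * X p * Z l))"
      using M X0 Z0 by (intro mult_left_mono add_mono mult_right_mono) auto
    also have "\<dots> = C * (G kp + G' kp)"
      by (simp add: C_def G_def G'_def kp l_def algebra_simps)
    finally show ?thesis .
  qed
  have Ds: "(\<lambda>kp. C * (G kp + G' kp)) summable_on UNIV"
    by (intro summable_on_cmult_right summable_on_add Gs Gs')
  have Rs: "(\<lambda>kp. norm (R kp)) summable_on UNIV"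
    by (rule summable_on_nonneg_comparison[OF Ds _ Rle]) auto
  hence Rs': "R summable_on UNIV" by (rule abs_summable_summable)
  have rapid_a: "rapid a"
    unfolding rapid_def
  proof
    fix N
    obtain C1 C2 where "\<And>k. norm (c k) \<le> C1 * inverse (norm (real_freq k) ^ N)"
      "\<And>k. norm (b k) \<le> C2 * inverse (norm (real_freq k) ^ N)"
      using c(1) b(1) unfolding rapid_def by meson
    hence "norm (a k) \<le> (C1 + C2) * inverse (norm (real_freq k) ^ N)" for k
      unfolding a_def distrib_right by (rule order_trans[OF norm_triangle_ineq add_mono])
    thus "\<exists>C. \<forall>k. norm (a k) \<le> C * inverse (norm (real_freq k) ^ N)" by blast
  qed
  have rapid_\<psi>: "rapid \<psi>"
    unfolding rapid_def
  proof
    fix N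
    obtain C1 where C1: "0 \<le> C1" "\<And>k. norm (c k) \<le> C1 * inverse (norm (real_freq k) ^ (n + N))"
      using rapidE[OF c(1)] by blast
    have "norm (\<psi> k) \<le> C1 * inverse (norm (real_freq k) ^ N)" for k
      using decay_weighted[of C1 c k n N] C1 by (simp add: \<psi>_def w_def norm_mult norm_power)
    thus "\<exists>C. \<forall>k. norm (\<psi> k) \<le> C * inverse (norm (real_freq k) ^ N)" by blast
  qed
  have a_sym: "a (- k) = cnj (a k)" for k by (simp add: a_def b(2) c(2))
  have Ts: "T summable_on UNIV" "Re (\<Sum>\<^sub>\<infinity>kp. T kp) = 0"
    using transport_antisymmetric[OF m rapid_a a_sym rapid_\<psi>] by (simp_all add: T_def)
  have QRT: "Q = (\<lambda>kp. R kp + T kp)" by (simp add: R_def)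
  show "Q summable_on UNIV"
    unfolding QRT by (intro summable_on_add Rs' Ts)
  have "(\<Sum>\<^sub>\<infinity>kp. Q kp) = (\<Sum>\<^sub>\<infinity>kp. R kp) + (\<Sum>\<^sub>\<infinity>kp. T kp)"
    unfolding QRT by (rule infsum_add[OF Rs' Ts(1)])
  hence "\<bar>Re (\<Sum>\<^sub>\<infinity>kp. Q kp)\<bar> \<le> norm (\<Sum>\<^sub>\<infinity>kp. R kp)"
    using Ts(2) abs_Re_le_cmod by simp
  also have "\<dots> \<le> (\<Sum>\<^sub>\<infinity>kp. norm (R kp))" by (rule norm_infsum_bound[OF Rs])
  also have "\<dots> \<le> (\<Sum>\<^sub>\<infinity>kp. C * (G kp + G' kp))"
    by (rule infsum_mono[OF Rs Ds Rle])
  also have "\<dots> = C * (infsum G UNIV + infsum G' UNIV)"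
    using Gs(1) Gs'(1) by (simp add: infsum_cmult_right infsum_add summable_on_add)
  also have "\<dots> \<le> C * (sobolev_energy n c * (\<Sum>\<^sub>\<infinity>k. Z k) + sobolev_energy n c * (\<Sum>\<^sub>\<infinity>k. Z k))"
    using M Gs(2) Gs'(2) by (intro mult_left_mono add_mono) (auto simp: C_def)
  also have "\<dots> = (M * 2 ^ n * (4 * real n + 4) * sobolev_energy n c) * (\<Sum>\<^sub>\<infinity>k. Z k)"
    by (simp add: C_def algebra_simps)
  also have "\<dots> \<le> (M * 2 ^ n * (4 * real n + 4) * sobolev_energy n c) *
      (sqrt (sobolev_energy n c) * (\<Sum>\<^sub>\<infinity>k. inverse (norm (real_freq k) ^ 6))
        + (\<Sum>\<^sub>\<infinity>k. norm (real_freq k) ^ (n + 1) * norm (b k)))"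
    using M sobolev_energy_nonneg[of n c] by (intro mult_left_mono ZI) auto
  finally show "\<bar>Re (\<Sum>\<^sub>\<infinity>kp. Q kp)\<bar> \<le> M * 2 ^ n * (4 * real n + 4) * sobolev_energy n c *
      (sqrt (sobolev_energy n c) * (\<Sum>\<^sub>\<infinity>k. inverse (norm (real_freq k) ^ 6))
        + (\<Sum>\<^sub>\<infinity>k. norm (real_freq k) ^ (n + 1) * norm (b k)))" .
qed

section \<open>Energy inequality in time\<close>

text \<open>The series of derivatives converges uniformly by the dominating \<open>D\<close>, is
  continuous, and may be integrated term by term. The series of functions is thus its value at 0
  plus the integral of a continuous function, and is differentiable up to the endpoints.\<close>

lemma has_real_derivative_infsum:
  fixes f f' :: "'i \<Rightarrow> real \<Rightarrow> real"
  assumes f: "\<And>k t. t \<in> {0..T} \<Longrightarrow> (f k has_real_derivative f' k t) (at t within {0..T})"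
    and f': "\<And>k. continuous_on {0..T} (f' k)"
    and D: "\<And>k t. t \<in> {0..T} \<Longrightarrow> \<bar>f' k t\<bar> \<le> D k" "D summable_on UNIV"
    and s: "\<And>t. t \<in> {0..T} \<Longrightarrow> (\<lambda>k. f k t) summable_on UNIV"
    and t: "t \<in> {0..T}"
  shows "((\<lambda>t. \<Sum>\<^sub>\<infinity>k. f k t) has_real_derivative (\<Sum>\<^sub>\<infinity>k. f' k t)) (at t within {0..T})"
proof -
  let ?S = "\<lambda>t. \<Sum>\<^sub>\<infinity>k. f' k t"
  have ul: "uniform_limit {0..T} (\<lambda>X t. \<Sum>k\<in>X. f' k t) ?S (finite_subsets_at_top UNIV)"
    by (rule Weierstrass_m_test_general[OF _ D(2)]) (use D(1) in auto)
  have contS: "continuous_on {0..T} ?S"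
    by (rule uniform_limit_theorem[OF _ ul]) (auto intro!: always_eventually continuous_on_sum f')
  have eq: "(\<Sum>\<^sub>\<infinity>k. f k r) = (\<Sum>\<^sub>\<infinity>k. f k 0) + integral {0..r} ?S" if r: "r \<in> {0..T}" for r
  proof -
    have sub: "{0..r} \<subseteq> {0..T}" using r by auto
    have ulr: "uniform_limit (cbox 0 r) (\<lambda>X t. \<Sum>k\<in>X. f' k t) ?S (finite_subsets_at_top UNIV)"
      using uniform_limit_on_subset[OF ul sub] by simp
    have cr: "continuous_on (cbox 0 r) (\<lambda>t. \<Sum>k\<in>X. f' k t)" for X
      using sub by (auto intro!: continuous_on_sum continuous_on_subset[OF f'])
    obtain I J where I: "\<And>X. ((\<lambda>t. \<Sum>k\<in>X. f' k t) has_integral I X) {0..r}"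
      and J: "(?S has_integral J) {0..r}" and lim: "(I \<longlongrightarrow> J) (finite_subsets_at_top UNIV)"
      by (rule uniform_limit_integral_cbox[OF ulr cr finite_subsets_at_top_neq_bot]) (auto intro: that)
    have int: "(f' k has_integral f k r - f k 0) {0..r}" for k
    proof (rule fundamental_theorem_of_calculus)
      show "(f k has_vector_derivative f' k x) (at x within {0..r})" if "x \<in> {0..r}" for x
        using f[of x k] that r sub
        by (auto simp: has_real_derivative_iff_has_vector_derivative intro: has_vector_derivative_within_subset)
    qed (use r in auto)
    have "I X = (\<Sum>k\<in>X. f k r - f k 0)" if "finite X" for X
      by (rule has_integral_unique[OF I has_integral_sum[OF that int]])
    hence "((\<lambda>k. f k r - f k 0) has_sum J) UNIV"
      unfolding has_sum_def
      by (intro Lim_transform_eventually[OF lim]) (auto intro!: eventually_finite_subsets_at_top_weakI)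
    moreover have "((\<lambda>k. f k r - f k 0) has_sum (\<Sum>\<^sub>\<infinity>k. f k r) - (\<Sum>\<^sub>\<infinity>k. f k 0)) UNIV"
      using has_sum_add[OF has_sum_infsum[OF s[OF r]] has_sum_uminusI[OF has_sum_infsum[OF s[of 0]]]] r
      by simp
    ultimately have "J = (\<Sum>\<^sub>\<infinity>k. f k r) - (\<Sum>\<^sub>\<infinity>k. f k 0)"
      by (rule has_sum_unique)
    thus ?thesis using integral_unique[OF J] by simp
  qed
  have "((\<lambda>r. (\<Sum>\<^sub>\<infinity>k. f k 0) + integral {0..r} ?S) has_real_derivative ?S t) (at t within {0..T})"
    using DERIV_add[OF DERIV_const integral_has_real_derivative[OF contS t]] by simp
  thus ?thesis
    by (rule has_field_derivative_transform_within[OF _ zero_less_one t]) (erule eq[symmetric])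
qed

text \<open>Here \<open>c\<close> is the difference, \<open>b\<close> the undamped solution and
  \<open>\<kappa> k\<close> the symbol of the diffusion. The damping and the diffusion of
  \<open>c\<close> are dropped by their sign. With \<open>z\<close> the energy plus
  \<open>\<mu>\<close>, both the energy and \<open>\<mu>\<close> are at most \<open>z\<close> and
  the root of the energy is at most \<open>1 + z\<close>; so every remaining term, the source
  included, is bounded by a multiple of \<open>z * (1 + z)\<close>.\<close>

lemma energy_rate_bound:
  fixes c c' b :: "int ^ 3 \<Rightarrow> complex"
  assumes m: "div_free_symbol M m" and n: "n \<ge> 7"
    and c: "rapid c" "\<And>k. c (- k) = cnj (c k)" and b: "rapid b" "\<And>k. b (- k) = cnj (b k)"
    and \<mu>: "0 \<le> \<mu>" and \<kappa>: "\<And>k. 0 \<le> \<kappa> k"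
    and B: "(\<Sum>\<^sub>\<infinity>k. norm (real_freq k) ^ (n + 1) * norm (b k)) \<le> B"
    and eq: "\<And>k. c' k = - (\<Sum>\<^sub>\<infinity>p. \<i> * of_real (m (k - p) \<bullet> real_freq p) *
        ((c (k - p) + b (k - p)) * c p + c (k - p) * b p))
        - of_real (\<mu> * (norm (real_freq k) + 1) + \<kappa> k) * c k - of_real (\<mu> * (norm (real_freq k) + 1)) * b k"
    and s: "(\<lambda>k. 2 * (norm (real_freq k) ^ n)\<^sup>2 * Re (cnj (c k) * c' k)) summable_on UNIV"
  defines "z \<equiv> sobolev_energy n c + \<mu>"
    and "P \<equiv> (\<Sum>\<^sub>\<infinity>k. inverse (norm (real_freq k) ^ 6))"
  shows "(\<Sum>\<^sub>\<infinity>k. 2 * (norm (real_freq k) ^ n)\<^sup>2 * Re (cnj (c k) * c' k))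
      \<le> (M * 2 ^ n * (8 * real n + 8) * (P + B) + 4 * B) * (z * (1 + z))"
proof -
  define w where "w = (\<lambda>k. norm (real_freq k) ^ n)"
  define g where "g = sobolev_energy n c"
  define q where "q = (\<lambda>k p. \<i> * of_real (m (k - p) \<bullet> real_freq p) *
        ((c (k - p) + b (k - p)) * c p + c (k - p) * b p))"
  define Q where "Q = (\<lambda>(k, p). of_real ((w k)\<^sup>2) * cnj (c k) * q k p)"
  have eq': "c' k = - (\<Sum>\<^sub>\<infinity>p. q k p)
        - of_real (\<mu> * (norm (real_freq k) + 1) + \<kappa> k) * c k - of_real (\<mu> * (norm (real_freq k) + 1)) * b k" for k
    by (simp only: eq q_def)
  \<comment> \<open>Majorant of the source. The 4 is 2 from differentiating a square times 2 from
    bounding the symbol |k| + 1 of the damping by 2 |k| at nonzero frequencies.\<close>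
  define E where "E = (\<lambda>k. 4 * (\<mu> * sqrt g) * (norm (real_freq k) ^ (n + 1) * norm (b k)))"
  have g0: "0 \<le> g" unfolding g_def by (rule sobolev_energy_nonneg)
  have M: "0 \<le> M"
    using m norm_ge_zero[of "m 0"] unfolding div_free_symbol_def by (meson order_trans)
  have P0: "0 \<le> P" unfolding P_def by (rule infsum_nonneg) simp
  have "0 \<le> (\<Sum>\<^sub>\<infinity>k. norm (real_freq k) ^ (n + 1) * norm (b k))"
    by (rule infsum_nonneg) simp
  hence B0: "0 \<le> B" using B by linarith
  have Qs: "Q summable_on UNIV"
    and Qb: "\<bar>Re (\<Sum>\<^sub>\<infinity>kp. Q kp)\<bar> \<le> M * 2 ^ n * (4 * real n + 4) * g * (sqrt g * P
        + (\<Sum>\<^sub>\<infinity>k. norm (real_freq k) ^ (n + 1) * norm (b k)))"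
    using nonlinear_energy_bound[OF m n c b] by (simp_all add: Q_def q_def w_def g_def P_def mult.assoc)
  let ?N = "\<lambda>k. \<Sum>\<^sub>\<infinity>p. Q (k, p)"
  \<comment> \<open>Summability over pairs permits iterated summation: the inner sum is what the
    equation at frequency \<open>k\<close> contains, the double sum is what the energy estimate
    bounds.\<close>
  have Qs2: "?N summable_on UNIV" and QI: "(\<Sum>\<^sub>\<infinity>k. ?N k) = infsum Q UNIV"
    using Qs summable_on_Sigma_banach[of "\<lambda>k p. Q (k, p)" UNIV "\<lambda>_. UNIV"] infsum_Sigma_banach[of Q UNIV "\<lambda>_. UNIV"]
    by simp_all
  have N: "?N k = of_real ((w k)\<^sup>2) * cnj (c k) * (\<Sum>\<^sub>\<infinity>p. q k p)" for k
    by (simp add: Q_def infsum_cmult_right')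
  have pw: "2 * (w k)\<^sup>2 * Re (cnj (c k) * c' k) \<le> - 2 * Re (?N k) + E k" for k
  proof -
    let ?r = "norm (real_freq k)"
    have "2 * (w k)\<^sup>2 * Re (cnj (c k) * c' k) = - 2 * Re (?N k)
        - 2 * (w k)\<^sup>2 * (\<mu> * (?r + 1) + \<kappa> k) * (norm (c k))\<^sup>2
        - 2 * (w k)\<^sup>2 * (\<mu> * (?r + 1)) * Re (cnj (c k) * b k)"
    proof -
      have "of_real ((w k)\<^sup>2) * (cnj (c k) * c' k) = - ?N k
         - of_real ((w k)\<^sup>2 * (\<mu> * (?r + 1) + \<kappa> k)) * (c k * cnj (c k))
         - of_real ((w k)\<^sup>2 * (\<mu> * (?r + 1))) * (cnj (c k) * b k)"
        unfolding eq' N by (simp add: algebra_simps)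
      also have "c k * cnj (c k) = of_real ((norm (c k))\<^sup>2)"
        by (rule complex_norm_square[symmetric])
      finally have "Re (of_real ((w k)\<^sup>2) * (cnj (c k) * c' k)) = Re (- ?N k
         - of_real ((w k)\<^sup>2 * (\<mu> * (?r + 1) + \<kappa> k)) * of_real ((norm (c k))\<^sup>2)
         - of_real ((w k)\<^sup>2 * (\<mu> * (?r + 1))) * (cnj (c k) * b k))" by simp
      moreover have "Re (of_real r * x) = r * Re x" for r x by simp
      ultimately have "(w k)\<^sup>2 * Re (cnj (c k) * c' k) = - Re (?N k)
         - (w k)\<^sup>2 * (\<mu> * (?r + 1) + \<kappa> k) * (norm (c k))\<^sup>2
         - (w k)\<^sup>2 * (\<mu> * (?r + 1)) * Re (cnj (c k) * b k)"
        by (simp only: minus_complex.sel uminus_complex.sel Re_complex_of_real)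
      from arg_cong[OF this, of "\<lambda>x. 2 * x"] show ?thesis
        by (simp only: right_diff_distrib mult_minus_right mult_minus_left mult.assoc)
    qed
    moreover have "0 \<le> 2 * (w k)\<^sup>2 * (\<mu> * (?r + 1) + \<kappa> k) * (norm (c k))\<^sup>2"
      using \<mu> \<kappa>[of k] by auto
    moreover have "- (2 * (w k)\<^sup>2 * (\<mu> * (?r + 1)) * Re (cnj (c k) * b k)) \<le> E k"
    proof -
      have "- Re (cnj (c k) * b k) \<le> norm (cnj (c k) * b k)"
        using abs_Re_le_cmod[of "cnj (c k) * b k"] by linarith
      hence "- Re (cnj (c k) * b k) \<le> norm (c k) * norm (b k)"
        by (simp add: norm_mult)
      hence "2 * (w k)\<^sup>2 * (\<mu> * (?r + 1)) * (- Re (cnj (c k) * b k))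
          \<le> 2 * (w k)\<^sup>2 * (\<mu> * (?r + 1)) * (norm (c k) * norm (b k))"
        using \<mu> by (intro mult_left_mono) auto
      also have "\<dots> = 2 * \<mu> * (w k * norm (c k)) * (?r ^ (n + 1) * norm (b k) + ?r ^ n * norm (b k))"
        by (simp add: w_def power2_eq_square algebra_simps)
      also have "\<dots> \<le> 2 * \<mu> * sqrt g * (?r ^ (n + 1) * norm (b k) + ?r ^ (n + 1) * norm (b k))"
        unfolding g_def w_def using \<mu> sobolev_energy_nonneg
        by (intro mult_mono mult_left_mono add_mono weight_mono rapid_zero b le_sqrt_sobolev_energy c) auto
      also have "\<dots> = E k" by (simp add: E_def)
      finally show ?thesis by (simp only: mult_minus_right)
    qed
    ultimately show ?thesis by linarith
  qed
  have Es: "E summable_on UNIV"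
    unfolding E_def by (intro summable_on_cmult_right rapid_summable b)
  have EI: "(\<Sum>\<^sub>\<infinity>k. E k) \<le> 4 * (\<mu> * sqrt g) * B"
    unfolding E_def using rapid_summable[OF b(1), of "n + 1"] B \<mu> g0
    by (subst infsum_cmult_right) (auto intro!: mult_left_mono)
  have Ns: "(\<lambda>k. - 2 * Re (?N k)) summable_on UNIV"
    by (intro summable_on_cmult_right summable_on_Re Qs2)
  have NI: "(\<Sum>\<^sub>\<infinity>k. - 2 * Re (?N k)) = - 2 * Re (infsum Q UNIV)"
    using infsum_Re[OF Qs2] summable_on_Re[OF Qs2] by (subst infsum_cmult_right) (auto simp: QI)
  have s': "(\<lambda>k. 2 * (w k)\<^sup>2 * Re (cnj (c k) * c' k)) summable_on UNIV"
    unfolding w_def by (rule s)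
  have sg: "sqrt g \<le> 1 + z"
  proof -
    have "sqrt g \<le> sqrt ((1 + g)\<^sup>2)"
      using g0 by (intro real_sqrt_le_mono) (simp add: power2_eq_square algebra_simps)
    thus ?thesis using g0 \<mu> by (simp add: z_def g_def)
  qed
  have gz: "g \<le> z" "\<mu> \<le> z" "0 \<le> z" using \<mu> g0 by (simp_all add: z_def g_def)
  have "(\<Sum>\<^sub>\<infinity>k. 2 * (w k)\<^sup>2 * Re (cnj (c k) * c' k)) \<le> (\<Sum>\<^sub>\<infinity>k. - 2 * Re (?N k) + E k)"
    by (rule infsum_mono[OF s' summable_on_add[OF Ns Es] pw])
  also have "\<dots> = - 2 * Re (infsum Q UNIV) + (\<Sum>\<^sub>\<infinity>k. E k)"
    by (subst infsum_add[OF Ns Es]) (simp only: NI)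
  also have "\<dots> \<le> 2 * (M * 2 ^ n * (4 * real n + 4) * g * (sqrt g * P + B)) + 4 * (\<mu> * sqrt g) * B"
  proof -
    have "M * 2 ^ n * (4 * real n + 4) * g * (sqrt g * P
        + (\<Sum>\<^sub>\<infinity>k. norm (real_freq k) ^ (n + 1) * norm (b k))) \<le> M * 2 ^ n * (4 * real n + 4) * g * (sqrt g * P + B)"
      using M g0 B by (intro mult_left_mono) auto
    with Qb EI show ?thesis by linarith
  qed
  also have "\<dots> \<le> 2 * (M * 2 ^ n * (4 * real n + 4) * z * ((1 + z) * P + (1 + z) * B)) + 4 * (z * (1 + z)) * B"
  proof -
    have "B \<le> (1 + z) * B" using gz B0 by (simp add: algebra_simps)
    moreover have "sqrt g * P \<le> (1 + z) * P" using sg P0 by (rule mult_right_mono)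
    ultimately have "M * 2 ^ n * (4 * real n + 4) * g * (sqrt g * P + B)
        \<le> M * 2 ^ n * (4 * real n + 4) * z * ((1 + z) * P + (1 + z) * B)"
      using M g0 gz sg P0 B0 by (intro mult_mono add_mono mult_left_mono) auto
    moreover have "4 * (\<mu> * sqrt g) * B \<le> 4 * (z * (1 + z)) * B"
      using sg gz \<mu> g0 B0 by (intro mult_right_mono mult_left_mono mult_mono) auto
    ultimately show ?thesis by linarith
  qed
  also have "\<dots> = (M * 2 ^ n * (8 * real n + 8) * (P + B) + 4 * B) * (z * (1 + z))"
    by (simp add: algebra_simps)
  finally show ?thesis by (simp add: w_def)
qed

text \<open>The differential inequality \<open>z' \<le> K z (1 + z)\<close> becomes linear for \<open>z / (1 + z)\<close>; hence no
  smallness argument is needed to exclude blow-up.\<close>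

lemma logistic_gronwall:
  fixes z :: "real \<Rightarrow> real"
  assumes T: "0 \<le> T" and z0: "\<And>t. t \<in> {0..T} \<Longrightarrow> 0 \<le> z t"
    and der: "\<And>t. t \<in> {0..T} \<Longrightarrow> (z has_real_derivative z' t) (at t within {0..T})"
    and le: "\<And>t. t \<in> {0<..<T} \<Longrightarrow> z' t \<le> K * (z t * (1 + z t))"
  shows "z T / (1 + z T) \<le> z 0 * exp (K * T)"
proof -
  define F where "F = (\<lambda>t. z t / (1 + z t) * exp (- K * t))"
  \<comment> \<open>The derivative of z / (1 + z) is z' / (1 + z)^2, and the integrating factor
    subtracts K z / (1 + z); over the common denominator the assumed inequality becomes
    visible.\<close>
  define F' where "F' = (\<lambda>t. (z' t - K * (z t * (1 + z t))) / (1 + z t)\<^sup>2 * exp (- K * t))"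
  have F: "(F has_real_derivative F' t) (at t within {0..T})" if "t \<in> {0..T}" for t
  proof -
    have "1 + z t \<noteq> 0" using z0[OF that] by linarith
    thus ?thesis
      unfolding F_def F'_def
      by (auto intro!: derivative_eq_intros der[OF that] simp: field_simps power2_eq_square)
  qed
  have "F T \<le> F 0"
  \<comment> \<open>The inequality is known at interior times only, because the equation is imposed
    for \<open>t > 0\<close>; continuity carries the monotonicity to the endpoints.\<close>
  proof (rule DERIV_nonpos_imp_decreasing_open[OF T])
    fix t assume t: "0 < t" "t < T"
    have "(F has_real_derivative F' t) (at t)"
      using F[of t] t at_within_interior[of t "{0..T}"] by (simp add: interior_atLeastAtMost_real)
    moreover have "F' t \<le> 0"
      using le[of t] t by (auto simp: F'_def intro!: mult_nonpos_nonneg divide_nonpos_nonneg)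
    ultimately show "\<exists>y. DERIV F t :> y \<and> y \<le> 0" by blast
  next
    show "continuous_on {0..T} F"
      using F by (meson DERIV_continuous_on)
  qed
  also have "F 0 \<le> z 0" using z0[of 0] T mult_left_mono[of 1 "1 + z 0" "z 0"] by (simp add: F_def divide_le_eq)
  finally have "z T / (1 + z T) * exp (- K * T) \<le> z 0" by (simp add: F_def)
  from mult_right_mono[OF this, of "exp (K * T)"] show ?thesis
    by (simp add: mult.assoc flip: exp_add)
qed

section \<open>Functions smooth on the closed half-space of times\<close>

abbreviation spacetime :: "(real \<times> (real ^ 3)) set" where
  "spacetime \<equiv> {0..} \<times> UNIV"

text \<open>Taken relative to the closed half-space, so that it is literally one of the derivatives
  over which \<open>smooth_on\<close> recurses and smoothness is inherited by unfolding.\<close>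

definition Dx :: "3 \<Rightarrow> (real \<times> (real ^ 3) \<Rightarrow> real) \<Rightarrow> real \<times> (real ^ 3) \<Rightarrow> real" where
  "Dx j f z = frechet_derivative f (at z within spacetime) (0, axis j 1)"

definition Dt :: "(real \<times> (real ^ 3) \<Rightarrow> real) \<Rightarrow> real \<times> (real ^ 3) \<Rightarrow> real" where
  "Dt f z = frechet_derivative f (at z within spacetime) (1, 0)"

lemma smooth_on_frechet:
  assumes "smooth_on A f" "b \<in> Basis"
  shows "smooth_on A (\<lambda>x. frechet_derivative f (at x within A) b)"
  unfolding smooth_on_def
proof
  fix n
  show "Cn_on n A (\<lambda>x. frechet_derivative f (at x within A) b)"
    using assms Cn_on.simps(2)[of n A f] unfolding smooth_on_def by blast
qed

lemma smooth_on_Dx: "smooth_on spacetime f \<Longrightarrow> smooth_on spacetime (Dx j f)"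
  unfolding Dx_def by (rule smooth_on_frechet) (auto simp: Basis_prod_def Basis_vec_def)

lemma smooth_on_Dt: "smooth_on spacetime f \<Longrightarrow> smooth_on spacetime (Dt f)"
  unfolding Dt_def by (rule smooth_on_frechet) (auto simp: Basis_prod_def)

lemma smooth_on_continuous: "smooth_on A f \<Longrightarrow> continuous_on A f"
  unfolding smooth_on_def using Cn_on.simps(1) by blast

lemma smooth_on_has_derivative:
  assumes "smooth_on A f" "z \<in> A"
  shows "(f has_derivative frechet_derivative f (at z within A)) (at z within A)"
proof -
  have "f differentiable_on A"
    using assms(1) Cn_on.simps(2)[of 0 A f] unfolding smooth_on_def by blast
  thus ?thesis
    using assms(2) by (simp add: differentiable_on_def frechet_derivative_works)
qed

lemma continuous_on_slice:
  assumes "smooth_on spacetime f" "0 \<le> t"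
  shows "continuous_on A (\<lambda>x. f (t, x))"
  by (rule continuous_on_compose2[OF smooth_on_continuous[OF assms(1)]])
    (use assms(2) in \<open>auto intro!: continuous_intros\<close>)

text \<open>A time slice of the half-space is all of space, also at \<open>t = 0\<close>;
  restricting the relative derivative to it gives an ordinary derivative in
  \<open>x\<close>.\<close>

lemma has_derivative_slice:
  assumes f: "smooth_on spacetime f" and t: "0 \<le> t"
  shows "((\<lambda>y. f (t, y)) has_derivative (\<lambda>v. frechet_derivative f (at (t, x) within spacetime) (0, v))) (at x)"
proof -
  have "(f has_derivative frechet_derivative f (at (t, x) within spacetime)) (at (t, x) within range (Pair t))"
    by (rule has_derivative_subset[OF smooth_on_has_derivative[OF f]]) (use t in auto)
  moreover have "((\<lambda>y. (t, y)) has_derivative (\<lambda>v. (0, v))) (at x)"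
    by (auto intro!: derivative_eq_intros)
  ultimately show ?thesis
    using diff_chain_within[of "\<lambda>y. (t, y)" "\<lambda>v. (0, v)" x UNIV f] by (simp add: o_def)
qed

lemma grad_slice:
  assumes "smooth_on spacetime f" "0 \<le> t"
  shows "grad (\<lambda>y. f (t, y)) x $ j = Dx j f (t, x)"
  using frechet_derivative_at[OF has_derivative_slice[OF assms, of x]]
  by (simp add: grad_def Dx_def) metis

lemma has_vector_derivative_slice:
  assumes f: "smooth_on spacetime f" and t: "0 \<le> t"
  shows "((\<lambda>s. f (t, x + axis j s)) has_vector_derivative Dx j f (t, x)) (at 0)"
proof -
  let ?D = "frechet_derivative f (at (t, x) within spacetime)"
  have ax: "axis j s = s *\<^sub>R (axis j 1 :: real ^ 3)" for s by (rule axis_scale)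
  have g: "((\<lambda>s. x + s *\<^sub>R axis j 1) has_derivative (\<lambda>s. s *\<^sub>R axis j 1)) (at 0)"
    by (auto intro!: derivative_eq_intros)
  have "((\<lambda>y. f (t, y)) has_derivative (\<lambda>v. ?D (0, v))) (at (x + 0 *\<^sub>R axis j 1))"
    using has_derivative_slice[OF f t, of x] by simp
  from diff_chain_at[OF g this]
  have "((\<lambda>s. f (t, x + s *\<^sub>R axis j 1)) has_derivative (\<lambda>s. ?D (0, s *\<^sub>R axis j 1))) (at 0)"
    by (simp add: o_def)
  moreover have "?D (0, s *\<^sub>R axis j 1) = s *\<^sub>R Dx j f (t, x)" for s
    using linear_scale[OF has_derivative_linear[OF smooth_on_has_derivative[OF f, of "(t, x)"]], of s "(0, axis j 1)"] t
    by (simp add: Dx_def)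
  ultimately show ?thesis
    unfolding has_vector_derivative_def ax[symmetric] by simp
qed

lemma has_vector_derivative_time:
  assumes f: "smooth_on spacetime f" and t: "t \<in> {0..T}"
  shows "((\<lambda>\<tau>. f (\<tau>, x)) has_vector_derivative Dt f (t, x)) (at t within {0..T})"
proof -
  let ?D = "frechet_derivative f (at (t, x) within spacetime)"
  have "(f has_derivative ?D) (at (t, x) within (\<lambda>\<tau>. (\<tau>, x)) ` {0..T})"
    by (rule has_derivative_subset[OF smooth_on_has_derivative[OF f]]) (use t in auto)
  moreover have "((\<lambda>\<tau>. (\<tau>, x)) has_derivative (\<lambda>s. (s, 0))) (at t within {0..T})"
    by (auto intro!: derivative_eq_intros)
  ultimately have "((\<lambda>\<tau>. f (\<tau>, x)) has_derivative (\<lambda>s. ?D (s, 0))) (at t within {0..T})"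
    using diff_chain_within[of "\<lambda>\<tau>. (\<tau>, x)" "\<lambda>s. (s, 0)" t "{0..T}" f] by (simp add: o_def)
  moreover have "?D (s, 0) = s *\<^sub>R Dt f (t, x)" for s
    using linear_scale[OF has_derivative_linear[OF smooth_on_has_derivative[OF f, of "(t, x)"]], of s "(1, 0)"] t
    by (simp add: Dt_def)
  ultimately show ?thesis
    unfolding has_vector_derivative_def by simp
qed

lemma deriv_time:
  assumes f: "smooth_on spacetime f" and t: "0 < t"
  shows "deriv (\<lambda>\<tau>. f (\<tau>, x)) t = Dt f (t, x)"
proof -
  have "((\<lambda>\<tau>. f (\<tau>, x)) has_vector_derivative Dt f (t, x)) (at t within {0..t + 1})"
    by (rule has_vector_derivative_time[OF f]) (use t in auto)
  hence "((\<lambda>\<tau>. f (\<tau>, x)) has_vector_derivative Dt f (t, x)) (at t)"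
    using t at_within_interior[of t "{0..t + 1}"] by (simp add: interior_atLeastAtMost_real)
  thus ?thesis
    by (simp add: DERIV_imp_deriv has_real_derivative_iff_has_vector_derivative)
qed

section \<open>Decay and time derivative of the Fourier coefficients\<close>

definition torus_coeff :: "(real \<times> (real ^ 3) \<Rightarrow> real) \<Rightarrow> real \<Rightarrow> int ^ 3 \<Rightarrow> complex" where
  "torus_coeff f t = fcoeff (\<lambda>x. of_real (f (t, x)))"

definition periodic_slices :: "(real \<times> (real ^ 3) \<Rightarrow> real) \<Rightarrow> bool" where
  "periodic_slices f \<longleftrightarrow> (\<forall>t\<ge>0. periodic (\<lambda>x. f (t, x)))"

lemma periodic_slices_Dx:
  assumes f: "smooth_on spacetime f" and per: "periodic_slices f"
  shows "periodic_slices (Dx j f)"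
  unfolding periodic_slices_def periodic_def
proof (intro allI impI)
  fix t x i assume t: "(0::real) \<le> t"
  have "f (t, x + axis i (2 * pi) + axis j s) = f (t, x + axis j s)" for s
    using per t unfolding periodic_slices_def periodic_def
    by (metis (no_types, lifting) add.assoc add.commute)
  with has_vector_derivative_slice[OF f t, of "x + axis i (2 * pi)" j]
  have "((\<lambda>s. f (t, x + axis j s)) has_vector_derivative Dx j f (t, x + axis i (2 * pi))) (at 0)"
    by simp
  thus "Dx j f (t, x + axis i (2 * pi)) = Dx j f (t, x)"
    using has_vector_derivative_slice[OF f t, of x j] vector_derivative_unique_at by blast
qed

lemma torus_coeff_Dx:
  assumes f: "smooth_on spacetime f" and per: "periodic_slices f" and t: "0 \<le> t"
  shows "torus_coeff (Dx j f) t k = \<i> * of_int (k $ j) * torus_coeff f t k"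
  unfolding torus_coeff_def
proof (rule fcoeff_derivative)
  show "((\<lambda>s. complex_of_real (f (t, x + axis j s))) has_vector_derivative complex_of_real (Dx j f (t, x))) (at 0)" for x
    using has_vector_derivative_slice[OF f t, of x j]
    by (intro has_vector_derivative_of_real) (simp add: has_real_derivative_iff_has_vector_derivative)
  show "complex_of_real (f (t, x + axis j (2 * pi))) = complex_of_real (f (t, x))" for x
    using per t by (simp add: periodic_slices_def periodic_def)
qed (intro continuous_intros continuous_on_slice smooth_on_Dx f t)+

lemma torus_coeff_iterated_Dx:
  assumes f: "smooth_on spacetime f" and per: "periodic_slices f"
  shows "smooth_on spacetime ((Dx j ^^ N) f) \<and> periodic_slices ((Dx j ^^ N) f) \<and>
    (\<forall>t\<ge>0. \<forall>k. torus_coeff ((Dx j ^^ N) f) t k = (\<i> * of_int (k $ j)) ^ N * torus_coeff f t k)"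
proof (induction N)
  case (Suc N)
  thus ?case
    by (auto simp: smooth_on_Dx periodic_slices_Dx torus_coeff_Dx)
qed (use f per in auto)

lemma norm_fcoeff_le:
  assumes f: "continuous_on torus_cell f" and C: "\<And>x. x \<in> torus_cell \<Longrightarrow> norm (f x) \<le> C" "0 \<le> C"
  shows "norm (fcoeff f k) \<le> C * measure lborel torus_cell / (2 * pi) ^ 3"
proof -
  have "norm (integral torus_cell (\<lambda>x. f x * cis (- (real_freq k \<bullet> x)))) \<le> C * measure lborel torus_cell"
    unfolding torus_cell_def
  proof (rule has_integral_bound[OF C(2) integrable_integral])
    show "(\<lambda>x. f x * cis (- (real_freq k \<bullet> x))) integrable_on cbox (\<chi> i. - pi) (\<chi> i. pi)"
      using f unfolding torus_cell_def by (intro integrable_continuous continuous_intros)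
  qed (use C in \<open>auto simp: norm_mult torus_cell_def\<close>)
  thus ?thesis
    by (simp add: fcoeff_def norm_divide norm_power divide_right_mono)
qed

text \<open>Compactness of the time interval times the cell. Uniformity in \<open>t\<close> is the
  point: these bounds later dominate series that are differentiated in time.\<close>

lemma torus_coeff_bounded:
  assumes f: "smooth_on spacetime f"
  shows "\<exists>C\<ge>0. \<forall>t\<in>{0..T}. \<forall>k. norm (torus_coeff f t k) \<le> C"
proof -
  have "compact ({0..T} \<times> torus_cell)"
    unfolding torus_cell_def by (intro compact_Times compact_Icc compact_cbox)
  moreover have "continuous_on ({0..T} \<times> torus_cell) f"
    by (rule continuous_on_subset[OF smooth_on_continuous[OF f]]) auto
  ultimately have "bounded (f ` ({0..T} \<times> torus_cell))"
    using compact_continuous_image compact_imp_bounded by blast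
  then obtain M where M: "\<And>z. z \<in> {0..T} \<times> torus_cell \<Longrightarrow> norm (f z) \<le> M" "0 \<le> M"
    by (auto simp: bounded_pos intro: less_imp_le)
  have "norm (torus_coeff f t k) \<le> M * measure lborel torus_cell / (2 * pi) ^ 3" if "t \<in> {0..T}" for t k
    unfolding torus_coeff_def
    by (rule norm_fcoeff_le) (use M that in \<open>auto intro!: continuous_intros continuous_on_slice f\<close>)
  moreover have "0 \<le> M * measure lborel torus_cell / (2 * pi) ^ 3"
    using M(2) by simp
  ultimately show ?thesis by blast
qed

lemma norm_real_freq_le_component: "\<exists>j. norm (real_freq k) \<le> 3 * \<bar>of_int (k $ j)\<bar>"
proof -
  have "norm (real_freq k) \<le> (\<Sum>j\<in>UNIV. \<bar>real_freq k $ j\<bar>)" by (rule norm_le_l1_cart)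
  hence "norm (real_freq k) \<le> \<bar>of_int (k $ 1)\<bar> + \<bar>of_int (k $ 2)\<bar> + \<bar>of_int (k $ 3)\<bar>"
    by (simp add: sum_3)
  hence "norm (real_freq k) \<le> 3 * \<bar>of_int (k $ 1)\<bar> \<or> norm (real_freq k) \<le> 3 * \<bar>of_int (k $ 2)\<bar>
      \<or> norm (real_freq k) \<le> 3 * \<bar>of_int (k $ 3)\<bar>" by linarith
  thus ?thesis by blast
qed

text \<open>Some component of \<open>k\<close> has at least a third of its norm, and
  \<open>N\<close> derivatives in that direction produce \<open>N\<close> powers of it. The
  direction depends on \<open>k\<close>, so the constants of all three directions are added.
  Frequency 0 gains nothing from derivatives and is covered by the assumed vanishing.\<close>

lemma torus_coeff_decay:
  assumes f: "smooth_on spacetime f" and per: "periodic_slices f"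
    and zero: "\<And>t. t \<in> {0..T} \<Longrightarrow> torus_coeff f t 0 = 0"
  shows "\<exists>C\<ge>0. \<forall>t\<in>{0..T}. \<forall>k. norm (torus_coeff f t k) \<le> C * inverse (norm (real_freq k) ^ N)"
proof -
  have "\<forall>j. \<exists>C\<ge>0. \<forall>t\<in>{0..T}. \<forall>k. norm (torus_coeff ((Dx j ^^ N) f) t k) \<le> C"
    using torus_coeff_bounded torus_coeff_iterated_Dx[OF f per] by blast
  then obtain C where C: "\<And>j. 0 \<le> C j" "\<And>j t k. t \<in> {0..T} \<Longrightarrow> norm (torus_coeff ((Dx j ^^ N) f) t k) \<le> C j"
    by metis
  have S0: "0 \<le> (\<Sum>j\<in>UNIV. C j)" by (intro sum_nonneg C)
  have "norm (torus_coeff f t k) \<le> 3 ^ N * (\<Sum>j\<in>UNIV. C j) * inverse (norm (real_freq k) ^ N)"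
    if t: "t \<in> {0..T}" for t k
  proof (cases "k = 0")
    case True
    thus ?thesis using zero[OF t] S0 by simp
  next
    case False
    hence pos: "0 < norm (real_freq k) ^ N" by simp
    obtain j where j: "norm (real_freq k) \<le> 3 * \<bar>of_int (k $ j)\<bar>"
      using norm_real_freq_le_component by blast
    have "norm (real_freq k) ^ N * norm (torus_coeff f t k) \<le> (3 * \<bar>of_int (k $ j)\<bar>) ^ N * norm (torus_coeff f t k)"
      by (intro mult_right_mono power_mono j) auto
    also have "\<dots> = 3 ^ N * norm (torus_coeff ((Dx j ^^ N) f) t k)"
      using torus_coeff_iterated_Dx[OF f per, where j = j and N = N] t
      by (simp add: norm_mult norm_power power_mult_distrib)
    also have "\<dots> \<le> 3 ^ N * (\<Sum>j\<in>UNIV. C j)"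
      using C(2)[OF t, of j k] member_le_sum[where i = j and A = UNIV and f = C] C(1) by (intro mult_left_mono) auto
    finally show ?thesis using pos by (simp add: field_simps)
  qed
  moreover have "0 \<le> 3 ^ N * (\<Sum>j\<in>UNIV. C j)" using S0 by simp
  ultimately show ?thesis by blast
qed

lemma torus_coeff_has_vector_derivative:
  assumes f: "smooth_on spacetime f" and t: "t \<in> {0..T}"
  shows "((\<lambda>t. torus_coeff f t k) has_vector_derivative torus_coeff (Dt f) t k) (at t within {0..T})"
proof -
  let ?e = "\<lambda>x. cis (- (real_freq k \<bullet> x))"
  have "((\<lambda>t. integral torus_cell (\<lambda>x. of_real (f (t, x)) * ?e x)) has_vector_derivative
      integral torus_cell (\<lambda>x. of_real (Dt f (t, x)) * ?e x)) (at t within {0..T})"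
    unfolding torus_cell_def
  proof (rule leibniz_rule_vector_derivative[OF _ _ _ t])
    show "((\<lambda>t. of_real (f (t, x)) * ?e x) has_vector_derivative of_real (Dt f (s, x)) * ?e x) (at s within {0..T})"
      if "s \<in> {0..T}" for s x
      using has_vector_derivative_time[OF f that, of x]
      by (intro has_vector_derivative_mult_left has_vector_derivative_of_real)
        (simp add: has_real_derivative_iff_has_vector_derivative)
    show "(\<lambda>x. of_real (f (s, x)) * ?e x) integrable_on cbox (\<chi> i. - pi) (\<chi> i. pi)" if "s \<in> {0..T}" for s
      using that by (intro integrable_continuous continuous_intros continuous_on_slice f) auto
    show "continuous_on ({0..T} \<times> cbox (\<chi> i. - pi) (\<chi> i. pi)) (\<lambda>(t, x). of_real (Dt f (t, x)) * ?e x)"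
      unfolding split_beta
      by (intro continuous_intros continuous_on_compose2[OF smooth_on_continuous[OF smooth_on_Dt[OF f]]]) auto
  qed simp
  from has_vector_derivative_mult_left[OF this, of "inverse (of_real ((2 * pi) ^ 3))"]
  show ?thesis
    unfolding torus_coeff_def fcoeff_def divide_inverse .
qed

lemma torus_coeff_uminus: "torus_coeff f t (- k) = cnj (torus_coeff f t k)"
proof -
  have "cnj (integral torus_cell (\<lambda>x. of_real (f (t, x)) * cis (- (real_freq k \<bullet> x))))
     = integral torus_cell (\<lambda>x. of_real (f (t, x)) * cis (real_freq k \<bullet> x))"
    by (simp add: Henstock_Kurzweil_Integration.integral_cnj cis_cnj)
  thus ?thesis
    by (simp add: torus_coeff_def fcoeff_def)
qed

section \<open>Solutions of the magnetogeostrophic equation\<close>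

lemma integrable_fcoeff:
  assumes "continuous_on UNIV f"
  shows "(\<lambda>x. f x * cis (- (real_freq k \<bullet> x))) integrable_on torus_cell"
  unfolding torus_cell_def
  by (intro integrable_continuous continuous_intros continuous_on_subset[OF assms]) auto

lemma fcoeff_add:
  assumes "continuous_on UNIV f" "continuous_on UNIV g"
  shows "fcoeff (\<lambda>x. f x + g x) k = fcoeff f k + fcoeff g k"
  unfolding fcoeff_def distrib_right
  by (simp add: Henstock_Kurzweil_Integration.integral_add integrable_fcoeff assms add_divide_distrib)

lemma fcoeff_cmult: "fcoeff (\<lambda>x. c * f x) k = c * fcoeff f k"
  unfolding fcoeff_def mult.assoc
  by (simp only: Henstock_Kurzweil_Integration.integral_mult_right times_divide_eq_right)

lemma fcoeff_sum:
  assumes "finite I" "\<And>i. i \<in> I \<Longrightarrow> continuous_on UNIV (f i)"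
  shows "fcoeff (\<lambda>x. \<Sum>i\<in>I. f i x) k = (\<Sum>i\<in>I. fcoeff (f i) k)"
  using assms
proof (induction I rule: finite_induct)
  case empty
  show ?case by (simp add: fcoeff_def)
next
  case (insert i I)
  have "fcoeff (\<lambda>x. f i x + (\<Sum>i\<in>I. f i x)) k = fcoeff (f i) k + fcoeff (\<lambda>x. \<Sum>i\<in>I. f i x) k"
    using insert.prems by (intro fcoeff_add continuous_on_sum) auto
  thus ?case using insert by simp
qed

lemma multiplier_summable:
  assumes a: "rapid a" and r: "\<And>k. k \<noteq> 0 \<Longrightarrow> \<bar>r k\<bar> \<le> R * norm (real_freq k) ^ N"
  shows "(\<lambda>k. norm (of_real (r k) * a k :: complex)) summable_on UNIV"
proof (rule summable_on_nonneg_comparison[OF summable_on_cmult_right[OF rapid_summable[OF a, of N], of R]])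
  show "norm (of_real (r k) * a k) \<le> R * (norm (real_freq k) ^ N * norm (a k))" for k
    using mult_right_mono[OF r[of k], of "norm (a k)"] rapid_zero[OF a]
    by (cases "k = 0") (auto simp: norm_mult mult.assoc)
qed auto

text \<open>Conjugation followed by k -> - k fixes the series, which is therefore real: the
  \<open>Re\<close> in the definition discards nothing.\<close>

lemma of_real_fourier_multiplier:
  assumes a: "rapid (fourier_coeff f)" "\<And>k. fourier_coeff f (- k) = cnj (fourier_coeff f k)"
    and r: "\<And>k. k \<noteq> 0 \<Longrightarrow> \<bar>r k\<bar> \<le> R * norm (real_freq k) ^ N" "\<And>k. r (- k) = r k"
  shows "of_real (fourier_multiplier r f x) =
    (\<Sum>\<^sub>\<infinity>k. (of_real (r k) * fourier_coeff f k) * cis (real_freq k \<bullet> x))"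
proof -
  let ?g = "\<lambda>k. (of_real (r k) * fourier_coeff f k) * cis (real_freq k \<bullet> x)"
  have "cnj (\<Sum>\<^sub>\<infinity>k. ?g k) = (\<Sum>\<^sub>\<infinity>k. cnj (?g k))"
    by (rule infsum_cnj[symmetric])
  also have "\<dots> = (\<Sum>\<^sub>\<infinity>k. ?g k)"
    by (rule infsum_reindex_bij_witness[of _ uminus uminus]) (auto simp: a(2) r(2) cis_cnj)
  finally have "(\<Sum>\<^sub>\<infinity>k. ?g k) \<in> \<real>" by (simp add: Reals_cnj_iff)
  thus ?thesis
    by (simp add: fourier_multiplier_def of_real_Re)
qed

text \<open>With r = |k| >= 1 the denominator is at least r^8, because of the square of k_2^2 + r^4,
  while each numerator is at most 3 r^8. Every component is then at most 3, and the l1 norm of the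
  vector at most 9.\<close>

lemma MG_symbol_bound: "norm (MG_symbol 1 (real_freq l)) \<le> 9"
proof (cases "l $ 3 = 0")
  case True
  thus ?thesis by (simp add: MG_symbol_def)
next
  case False
  hence l: "l \<noteq> 0" by auto
  let ?k = "real_freq l"
  define r where "r = norm ?k"
  have r1: "1 \<le> r" unfolding r_def by (rule norm_real_freq_ge_1[OF l])
  have c: "\<bar>?k $ j\<bar> \<le> r" for j unfolding r_def by (rule component_le_norm_cart)
  define q where "q = (?k $ 2)\<^sup>2 + r ^ 4"
  have c2: "(?k $ j)\<^sup>2 \<le> r\<^sup>2" for j using c[of j] power_mono[of "\<bar>?k $ j\<bar>" r 2] by simp
  have r24: "r ^ 2 \<le> r ^ 4" using r1 by (intro power_increasing) auto
  have q: "0 \<le> q" "q \<le> 2 * r ^ 4" "r ^ 4 \<le> q"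
    unfolding q_def using c2[of 2] r24 by (auto intro: add_nonneg_nonneg)
  have D: "r ^ 8 \<le> MG_denom 1 ?k"
  proof -
    have "r ^ 8 = (r ^ 4)\<^sup>2" by (simp flip: power_mult)
    also have "\<dots> \<le> q\<^sup>2" using q(3) r1 by (intro power_mono) auto
    also have "\<dots> \<le> MG_denom 1 ?k" unfolding MG_denom_def q_def r_def by simp
    finally show ?thesis .
  qed
  have r8: "0 < r ^ 8" "r ^ 4 \<le> r ^ 8" "r ^ 6 \<le> r ^ 8"
    using r1 by (auto intro!: power_increasing)
  have D0: "0 < MG_denom 1 ?k" using D r8 by linarith
  have p: "\<bar>?k $ i * ?k $ j\<bar> \<le> r\<^sup>2" for i j
    unfolding abs_mult power2_eq_square using c r1 by (intro mult_mono) auto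
  have b1: "\<bar>?k $ i * ?k $ j * r\<^sup>2\<bar> \<le> r ^ 8" for i j
  proof -
    have "\<bar>?k $ i * ?k $ j * r\<^sup>2\<bar> \<le> r\<^sup>2 * r\<^sup>2"
      unfolding abs_mult[of _ "r\<^sup>2"] using p[of i j] by (intro mult_mono) auto
    also have "\<dots> = r ^ 4" by (simp flip: power_add)
    finally show ?thesis using r8 by linarith
  qed
  have b2: "\<bar>?k $ i * ?k $ j * q\<bar> \<le> 2 * r ^ 8" for i j
  proof -
    have "\<bar>?k $ i * ?k $ j * q\<bar> \<le> r\<^sup>2 * (2 * r ^ 4)"
      unfolding abs_mult[of _ q] using p[of i j] q by (intro mult_mono) auto
    also have "\<dots> = 2 * r ^ 6" by (simp flip: power_add)
    finally show ?thesis using r8 by linarith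
  qed
  have d: "\<bar>x / MG_denom 1 ?k\<bar> \<le> 3" if "\<bar>x\<bar> \<le> 3 * r ^ 8" for x
    using that D D0 by (simp add: abs_divide pos_divide_le_eq)
  have m: "MG_symbol 1 ?k = vector
     [(?k $ 2 * ?k $ 3 * r\<^sup>2 - ?k $ 1 * ?k $ 3 * q) / MG_denom 1 ?k,
      (- ?k $ 1 * ?k $ 3 * r\<^sup>2 - ?k $ 2 * ?k $ 3 * q) / MG_denom 1 ?k,
      ((?k $ 1)\<^sup>2 + (?k $ 2)\<^sup>2) * q / MG_denom 1 ?k]"
    using False by (simp add: MG_symbol_def q_def r_def)
  have 3: "\<bar>((?k $ 1)\<^sup>2 + (?k $ 2)\<^sup>2) * q\<bar> \<le> 3 * r ^ 8"
  proof -
    have "(?k $ 1)\<^sup>2 + (?k $ 2)\<^sup>2 \<le> r\<^sup>2"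
      unfolding r_def by (simp add: norm_vec_def L2_set_def sum_3)
    hence "((?k $ 1)\<^sup>2 + (?k $ 2)\<^sup>2) * q \<le> r\<^sup>2 * (2 * r ^ 4)"
      using q by (intro mult_mono) auto
    also have "\<dots> = 2 * r ^ 6" by (simp flip: power_add)
    finally show ?thesis using r8 q by (simp add: abs_mult)
  qed
  have "\<bar>MG_symbol 1 ?k $ j\<bar> \<le> 3" for j
  proof -
    have "j = 1 \<or> j = 2 \<or> j = 3" by (rule exhaust_3)
    thus ?thesis
    proof (elim disjE)
      assume "j = 1"
      thus ?thesis unfolding m
        using b1[of 2 3] b2[of 1 3] by (auto simp only: vector_3 intro!: d)
    next
      assume "j = 2"
      thus ?thesis unfolding m
        using b1[of 1 3] b2[of 2 3] by (auto simp only: vector_3 mult_minus_left intro!: d)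
    next
      assume "j = 3"
      thus ?thesis unfolding m
        using 3 by (auto simp only: vector_3 intro!: d)
    qed
  qed
  hence "(\<Sum>j\<in>UNIV. \<bar>MG_symbol 1 ?k $ j\<bar>) \<le> (\<Sum>j\<in>(UNIV :: 3 set). 3)"
    by (intro sum_mono)
  thus ?thesis
    using norm_le_l1_cart[of "MG_symbol 1 ?k"] by simp
qed

text \<open>In the scalar product with k the two terms with |k|^2 cancel between the first and
  second component, and those with k_2^2 + |k|^4 cancel against the third. Evenness holds since all
  entries have even total degree.\<close>

lemma div_free_symbol_MG: "div_free_symbol 9 (\<lambda>l. MG_symbol 1 (real_freq l))"
  unfolding div_free_symbol_def
proof (intro conjI allI)
  show "MG_symbol 1 (real_freq (- l)) = MG_symbol 1 (real_freq l)" for l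
    by (simp add: MG_symbol_def MG_denom_def)
  show "MG_symbol 1 (real_freq l) \<bullet> real_freq l = 0" for l
  proof (cases "l $ 3 = 0")
    case False
    have "MG_symbol 1 (real_freq l) \<bullet> real_freq l = (\<Sum>j\<in>UNIV. MG_symbol 1 (real_freq l) $ j * real_freq l $ j)"
      by (simp add: inner_vec_def)
    also have "\<dots> = 0"
      using False by (simp add: sum_3 MG_symbol_def vector_3 flip: add_divide_distrib) (simp add: algebra_simps power2_eq_square)
    finally show ?thesis .
  qed (simp add: MG_symbol_def)
qed (rule MG_symbol_bound)

lemma norm_powr_bound:
  assumes "k \<noteq> 0" "s \<le> real N"
  shows "\<bar>norm (real_freq k) powr s\<bar> \<le> 1 * norm (real_freq k) ^ N"
  using powr_mono[of s "real N" "norm (real_freq k)"] norm_real_freq_ge_1[OF assms(1)] assms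
  by (simp add: powr_realpow)

section \<open>The equation on the Fourier side\<close>

context
  fixes \<kappa> \<gamma> \<mu> :: real and S \<theta>\<^sub>0 :: "real ^ 3 \<Rightarrow> real" and \<theta> :: "real \<Rightarrow> real ^ 3 \<Rightarrow> real"
  assumes sol: "smooth_MG_solution \<kappa> \<gamma> \<mu> S \<theta>\<^sub>0 \<theta>"
begin

abbreviation (input) "sol_coeff \<equiv> torus_coeff (\<lambda>(t, x). \<theta> t x)"

lemma sol_smooth: "smooth_on spacetime (\<lambda>(t, x). \<theta> t x)"
  using sol by (simp add: smooth_MG_solution_def)

lemma sol_continuous: "0 \<le> t \<Longrightarrow> continuous_on A (\<theta> t)"
  using continuous_on_slice[OF sol_smooth] by simp

lemma sol_fourier_coeff: "0 \<le> t \<Longrightarrow> fourier_coeff (\<theta> t) = sol_coeff t"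
  using fourier_coeff_eq_fcoeff[OF sol_continuous] by (auto simp: torus_coeff_def)

lemma sol_periodic: "periodic_slices (\<lambda>(t, x). \<theta> t x)"
  using sol by (simp add: smooth_MG_solution_def periodic_slices_def)

lemma sol_coeff_0:
  assumes "0 \<le> t"
  shows "sol_coeff t 0 = 0"
proof -
  have "zero_mean (\<theta> t)" using sol assms by (simp add: smooth_MG_solution_def)
  hence "fourier_coeff (\<theta> t) 0 = 0"
    by (simp add: zero_mean_def fourier_coeff_def set_integral_complex_of_real)
  thus ?thesis using sol_fourier_coeff[OF assms] by simp
qed

lemma sol_decay:
  "\<exists>C\<ge>0. \<forall>t\<in>{0..T}. \<forall>k. norm (sol_coeff t k) \<le> C * inverse (norm (real_freq k) ^ N)"
  by (rule torus_coeff_decay[OF sol_smooth sol_periodic]) (simp add: sol_coeff_0)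

lemma sol_rapid: "0 \<le> t \<Longrightarrow> rapid (sol_coeff t)"
  unfolding rapid_def using sol_decay[of t] by (metis atLeastAtMost_iff order_refl)

text \<open>The velocity and the powers of \<Lambda> are series in the coefficients of the solution,
  so their own coefficients are read off termwise; rapid decay absorbs a symbol of polynomial
  growth.\<close>

lemma sol_multiplier:
  assumes t: "0 \<le> t" and r: "\<And>k. k \<noteq> 0 \<Longrightarrow> \<bar>r k\<bar> \<le> R * norm (real_freq k) ^ N" "\<And>k. r (- k) = r k"
  shows "(\<lambda>k. norm (of_real (r k) * sol_coeff t k)) summable_on UNIV"
    and "(\<lambda>x. of_real (fourier_multiplier r (\<theta> t) x)) =
      (\<lambda>x. \<Sum>\<^sub>\<infinity>k. (of_real (r k) * sol_coeff t k) * cis (real_freq k \<bullet> x))"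
    and "continuous_on UNIV (\<lambda>x. complex_of_real (fourier_multiplier r (\<theta> t) x))"
    and "fcoeff (\<lambda>x. of_real (fourier_multiplier r (\<theta> t) x)) k = of_real (r k) * sol_coeff t k"
proof -
  show s: "(\<lambda>k. norm (of_real (r k) * sol_coeff t k)) summable_on UNIV"
    by (rule multiplier_summable[OF sol_rapid[OF t] r(1)])
  show eq: "(\<lambda>x. of_real (fourier_multiplier r (\<theta> t) x)) =
      (\<lambda>x. \<Sum>\<^sub>\<infinity>k. (of_real (r k) * sol_coeff t k) * cis (real_freq k \<bullet> x))"
    using of_real_fourier_multiplier[of "\<theta> t" r R N] sol_rapid[OF t] r
    by (simp add: sol_fourier_coeff[OF t] torus_coeff_uminus)
  show "continuous_on UNIV (\<lambda>x. complex_of_real (fourier_multiplier r (\<theta> t) x))"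
    unfolding eq by (rule continuous_on_fourier_series[OF s])
  show "fcoeff (\<lambda>x. of_real (fourier_multiplier r (\<theta> t) x)) k = of_real (r k) * sol_coeff t k"
    unfolding eq by (rule fcoeff_series[OF s])
qed

lemma sol_transport:
  assumes t: "0 \<le> t"
  defines "m \<equiv> \<lambda>l. MG_symbol 1 (real_freq l)"
  shows "((\<lambda>p. \<i> * of_real (m (k - p) \<bullet> real_freq p) * (sol_coeff t (k - p) * sol_coeff t p)) has_sum
      fcoeff (\<lambda>x. of_real (MG_velocity (\<theta> t) x \<bullet> grad (\<theta> t) x)) k) UNIV"
    and "continuous_on UNIV (\<lambda>x. complex_of_real (MG_velocity (\<theta> t) x \<bullet> grad (\<theta> t) x))"
proof -
  let ?u = "\<lambda>j x. complex_of_real (fourier_multiplier (\<lambda>k. m k $ j) (\<theta> t) x)"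
  let ?d = "\<lambda>j x. complex_of_real (Dx j (\<lambda>(t, x). \<theta> t x) (t, x))"
  have r: "\<bar>m k $ j\<bar> \<le> 9 * norm (real_freq k) ^ 0" "m (- k) $ j = m k $ j" for k j
    using component_le_norm_cart[of "m k" j] div_free_symbol_MG unfolding m_def div_free_symbol_def
    by (auto intro: order_trans)
  have dc: "continuous_on UNIV (?d j)" for j
    by (intro continuous_intros continuous_on_slice smooth_on_Dx sol_smooth t)
  have eq: "(\<lambda>x. complex_of_real (MG_velocity (\<theta> t) x \<bullet> grad (\<theta> t) x)) = (\<lambda>x. \<Sum>j\<in>UNIV. ?u j x * ?d j x)"
    using grad_slice[OF sol_smooth t] by (simp add: inner_vec_def MG_velocity_def m_def)
  have uc: "continuous_on UNIV (?u j)" for j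
    by (rule sol_multiplier(3)[OF t r])
  show "continuous_on UNIV (\<lambda>x. complex_of_real (MG_velocity (\<theta> t) x \<bullet> grad (\<theta> t) x))"
    unfolding eq by (intro continuous_on_sum continuous_on_mult uc dc)
  have H: "((\<lambda>l. of_real (m l $ j) * sol_coeff t l * fcoeff (?d j) (k - l)) has_sum fcoeff (\<lambda>x. ?u j x * ?d j x) k) UNIV" for j
    unfolding fun_cong[OF sol_multiplier(2)[OF t r]]
    by (rule fcoeff_series_mult[OF sol_multiplier(1)[OF t r] dc])
  have "((\<lambda>l. \<Sum>j\<in>UNIV. of_real (m l $ j) * sol_coeff t l * fcoeff (?d j) (k - l)) has_sum
      (\<Sum>j\<in>UNIV. fcoeff (\<lambda>x. ?u j x * ?d j x) k)) UNIV"
    unfolding sum_3 by (intro has_sum_add H)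
  also have "(\<Sum>j\<in>UNIV. fcoeff (\<lambda>x. ?u j x * ?d j x) k) = fcoeff (\<lambda>x. \<Sum>j\<in>UNIV. ?u j x * ?d j x) k"
    by (rule fcoeff_sum[symmetric]) (auto intro!: continuous_on_mult uc dc)
  also have "(\<lambda>l. \<Sum>j\<in>UNIV. of_real (m l $ j) * sol_coeff t l * fcoeff (?d j) (k - l)) =
      (\<lambda>l. \<i> * of_real (m l \<bullet> real_freq (k - l)) * (sol_coeff t l * sol_coeff t (k - l)))"
  proof
    fix l
    have "fcoeff (?d j) (k - l) = \<i> * of_int ((k - l) $ j) * sol_coeff t (k - l)" for j
      using torus_coeff_Dx[OF sol_smooth sol_periodic t] by (simp add: torus_coeff_def)
    thus "(\<Sum>j\<in>UNIV. of_real (m l $ j) * sol_coeff t l * fcoeff (?d j) (k - l)) =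
        \<i> * of_real (m l \<bullet> real_freq (k - l)) * (sol_coeff t l * sol_coeff t (k - l))"
      by (simp add: inner_vec_def sum_distrib_left sum_distrib_right mult_ac del: real_freq_simps(2) vector_minus_component)
  qed
  finally have "((\<lambda>l. \<i> * of_real (m l \<bullet> real_freq (k - l)) * (sol_coeff t l * sol_coeff t (k - l))) has_sum
      fcoeff (\<lambda>x. of_real (MG_velocity (\<theta> t) x \<bullet> grad (\<theta> t) x)) k) UNIV"
    unfolding eq .
  \<comment> \<open>The convolution theorem sums over the frequency of the velocity; the
    substitution p = k - l sums over the transported frequency instead.\<close>
  thus "((\<lambda>p. \<i> * of_real (m (k - p) \<bullet> real_freq p) * (sol_coeff t (k - p) * sol_coeff t p)) has_sum
      fcoeff (\<lambda>x. of_real (MG_velocity (\<theta> t) x \<bullet> grad (\<theta> t) x)) k) UNIV"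
    by (subst has_sum_reindex_bij_witness[of UNIV "\<lambda>p. k - p" "\<lambda>p. k - p" UNIV
          "\<lambda>l. \<i> * of_real (m l \<bullet> real_freq (k - l)) * (sol_coeff t l * sol_coeff t (k - l))"])
      auto
qed

text \<open>All terms on the left of the equation are continuous in \<open>x\<close>, so the
  coefficient may be taken term by term. That of \<open>S\<close> is left unevaluated, since it
  cancels between two solutions.\<close>

lemma sol_ode:
  assumes t: "0 < t"
  shows "torus_coeff (Dt (\<lambda>(t, x). \<theta> t x)) t k =
    fcoeff (\<lambda>x. of_real (S x)) k
    - (\<Sum>\<^sub>\<infinity>p. \<i> * of_real (MG_symbol 1 (real_freq (k - p)) \<bullet> real_freq p) * (sol_coeff t (k - p) * sol_coeff t p))
    - of_real (\<mu> * (norm (real_freq k) + 1) + \<kappa> * norm (real_freq k) powr \<gamma>) * sol_coeff t k"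
proof -
  have t0: "0 \<le> t" using t by simp
  let ?n = "\<lambda>x. complex_of_real (MG_velocity (\<theta> t) x \<bullet> grad (\<theta> t) x)"
  let ?a = "\<lambda>x. complex_of_real (Dt (\<lambda>(t, x). \<theta> t x) (t, x))"
  have L: "continuous_on UNIV (\<lambda>x. complex_of_real (Lambda_pow s (\<theta> t) x))"
    "fcoeff (\<lambda>x. of_real (Lambda_pow s (\<theta> t) x)) k = of_real (norm (real_freq k) powr s) * sol_coeff t k" for s
    unfolding Lambda_pow_def
    by (rule sol_multiplier(3,4)[OF t0 norm_powr_bound[where N = "nat \<lceil>s\<rceil>"]]; simp add: of_nat_ceiling)+
  have cont: "continuous_on UNIV ?a" "continuous_on UNIV ?n" "continuous_on UNIV (\<lambda>x. complex_of_real (\<theta> t x))"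
    by (intro continuous_intros continuous_on_slice smooth_on_Dt sol_smooth t0 sol_transport(2) sol_continuous)+
  have "of_real (S x) = ?a x + (?n x + (of_real \<mu> * of_real (Lambda_pow 1 (\<theta> t) x) +
      (of_real \<mu> * of_real (\<theta> t x) + of_real \<kappa> * of_real (Lambda_pow \<gamma> (\<theta> t) x))))" for x
  proof -
    have "deriv (\<lambda>\<tau>. \<theta> \<tau> x) t + MG_velocity (\<theta> t) x \<bullet> grad (\<theta> t) x
          + \<mu> * damping (\<theta> t) x + \<kappa> * Lambda_pow \<gamma> (\<theta> t) x = S x"
      using sol t by (simp add: smooth_MG_solution_def)
    moreover have "deriv (\<lambda>\<tau>. \<theta> \<tau> x) t = Dt (\<lambda>(t, x). \<theta> t x) (t, x)"
      using deriv_time[OF sol_smooth t, of x] by simp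
    ultimately have "S x = Dt (\<lambda>(t, x). \<theta> t x) (t, x) + (MG_velocity (\<theta> t) x \<bullet> grad (\<theta> t) x + (\<mu> * Lambda_pow 1 (\<theta> t) x +
      (\<mu> * \<theta> t x + \<kappa> * Lambda_pow \<gamma> (\<theta> t) x)))"
      by (simp add: damping_def algebra_simps)
    thus ?thesis by (simp only: of_real_add of_real_mult)
  qed
  hence "fcoeff (\<lambda>x. of_real (S x)) k = fcoeff ?a k + (fcoeff ?n k + (of_real \<mu> * (of_real (norm (real_freq k) powr 1) * sol_coeff t k)
      + (of_real \<mu> * sol_coeff t k + of_real \<kappa> * (of_real (norm (real_freq k) powr \<gamma>) * sol_coeff t k))))"
    using cont L
    by (simp add: fcoeff_add fcoeff_cmult continuous_on_add continuous_on_mult torus_coeff_def)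
  thus ?thesis
    using infsumI[OF sol_transport(1)[OF t0, of k]]
    by (simp add: torus_coeff_def algebra_simps)
qed

end

section \<open>Convergence\<close>

text \<open>Equal initial data make the energy of the difference vanish at time 0, so
  \<open>z\<close> starts at \<open>\<mu>\<close> and the logistic estimate propagates this. The
  rate contains the symbol bound 9 and the norm \<open>B\<close> of the undamped solution, nothing
  of \<open>\<theta>\<close>.\<close>

lemma difference_energy_bound:
  assumes sol: "smooth_MG_solution \<kappa> \<gamma> \<mu> S \<theta>\<^sub>0 \<theta>" and sol0: "smooth_MG_solution \<kappa> \<gamma> 0 S \<theta>\<^sub>0 \<phi>"
    and \<kappa>: "0 \<le> \<kappa>" and \<mu>: "0 \<le> \<mu>" and T: "0 \<le> T" and n: "n \<ge> 7"
  defines "a \<equiv> torus_coeff (\<lambda>(t, x). \<theta> t x)" and "b \<equiv> torus_coeff (\<lambda>(t, x). \<phi> t x)"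
    and "P \<equiv> (\<Sum>\<^sub>\<infinity>k. inverse (norm (real_freq k) ^ 6))"
  assumes B: "\<And>t. t \<in> {0..T} \<Longrightarrow> (\<Sum>\<^sub>\<infinity>k. norm (real_freq k) ^ (n + 1) * norm (b t k)) \<le> B"
  defines "z \<equiv> sobolev_energy n (\<lambda>k. a T k - b T k) + \<mu>"
  shows "z / (1 + z) \<le> \<mu> * exp ((9 * 2 ^ n * (8 * real n + 8) * (P + B) + 4 * B) * T)"
proof -
  let ?F = "\<lambda>(t, x). \<theta> t x" and ?G = "\<lambda>(t, x). \<phi> t x"
  note F = sol_smooth[OF sol] and G = sol_smooth[OF sol0]
  define c where "c = (\<lambda>t k. a t k - b t k)"
  define c' where "c' = (\<lambda>t k. torus_coeff (Dt ?F) t k - torus_coeff (Dt ?G) t k)"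
  define f where "f = (\<lambda>k t. (norm (real_freq k) ^ n * norm (c t k))\<^sup>2)"
  define f' where "f' = (\<lambda>k t. 2 * (norm (real_freq k) ^ n)\<^sup>2 * Re (cnj (c t k) * c' t k))"
  have decay: "\<exists>C\<ge>0. \<forall>t\<in>{0..T}. \<forall>k. norm (c t k) \<le> C * inverse (norm (real_freq k) ^ N)" for N
  proof -
    obtain C1 C2 where C: "0 \<le> C1" "0 \<le> C2"
      "\<forall>t\<in>{0..T}. \<forall>k. norm (a t k) \<le> C1 * inverse (norm (real_freq k) ^ N)"
      "\<forall>t\<in>{0..T}. \<forall>k. norm (b t k) \<le> C2 * inverse (norm (real_freq k) ^ N)"
      using sol_decay[OF sol, of T N] sol_decay[OF sol0, of T N] unfolding a_def b_def by blast
    have "norm (c t k) \<le> (C1 + C2) * inverse (norm (real_freq k) ^ N)" if "t \<in> {0..T}" for t k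
      unfolding c_def distrib_right
      by (rule order_trans[OF norm_triangle_ineq4 add_mono]) (use C that in blast)+
    thus ?thesis using C by (intro exI[of _ "C1 + C2"]) auto
  qed
  have c_rapid: "rapid (c t)" if "t \<in> {0..T}" for t
    unfolding rapid_def using decay that by blast
  have b_rapid: "rapid (b t)" if "t \<in> {0..T}" for t
    unfolding b_def by (rule sol_rapid[OF sol0]) (use that in auto)
  have sym: "c t (- k) = cnj (c t k)" "b t (- k) = cnj (b t k)" for t k
    by (simp_all add: c_def a_def b_def torus_coeff_uminus)
  have c_deriv: "((\<lambda>t. c t k) has_vector_derivative c' t k) (at t within {0..T})" if "t \<in> {0..T}" for t k
    unfolding c_def c'_def a_def b_def
    by (intro has_vector_derivative_diff torus_coeff_has_vector_derivative F G that)
  have c_cont: "continuous_on {0..T} (\<lambda>t. c t k)" for k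
    using c_deriv by (rule continuous_on_vector_derivative)
  have c'_cont: "continuous_on {0..T} (\<lambda>t. c' t k)" for k
    unfolding c'_def
    by (intro continuous_on_diff; rule continuous_on_vector_derivative;
        rule torus_coeff_has_vector_derivative; (intro smooth_on_Dt F G)?)
  obtain D where D: "0 \<le> D" "\<And>t k. t \<in> {0..T} \<Longrightarrow> norm (c' t k) \<le> D"
  proof -
    obtain D1 D2 where D12: "0 \<le> D1" "0 \<le> D2"
      "\<forall>t\<in>{0..T}. \<forall>k. norm (torus_coeff (Dt ?F) t k) \<le> D1"
      "\<forall>t\<in>{0..T}. \<forall>k. norm (torus_coeff (Dt ?G) t k) \<le> D2"
      using torus_coeff_bounded[OF smooth_on_Dt[OF F], of T] torus_coeff_bounded[OF smooth_on_Dt[OF G], of T]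
      by blast
    have "norm (c' t k) \<le> D1 + D2" if "t \<in> {0..T}" for t k
      unfolding c'_def by (rule order_trans[OF norm_triangle_ineq4 add_mono]) (use D12 that in blast)+
    thus ?thesis using D12 by (intro that[of "D1 + D2"]) auto
  qed
  \<comment> \<open>For \<open>c'\<close> a uniform bound is enough, because \<open>c\<close>
    supplies all the decay: \<open>2 * n\<close> powers compensate the squared weight and 6 make the
    majorant summable.\<close>
  obtain C where C: "0 \<le> C" "\<And>t k. t \<in> {0..T} \<Longrightarrow> norm (c t k) \<le> C * inverse (norm (real_freq k) ^ (2 * n + 6))"
    using decay[of "2 * n + 6"] by blast
  have f_deriv: "(f k has_real_derivative f' k t) (at t within {0..T})" if t: "t \<in> {0..T}" for k t
  proof -
    have "((\<lambda>t. c t k \<bullet> c t k) has_vector_derivative (c t k \<bullet> c' t k + c' t k \<bullet> c t k)) (at t within {0..T})"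
      by (rule bounded_bilinear.has_vector_derivative[OF bounded_bilinear_inner c_deriv[OF t] c_deriv[OF t]])
    hence "((\<lambda>t. c t k \<bullet> c t k) has_real_derivative (2 * Re (cnj (c t k) * c' t k))) (at t within {0..T})"
      by (simp add: has_real_derivative_iff_has_vector_derivative inner_complex_def algebra_simps)
    from DERIV_cmult[OF this, of "(norm (real_freq k) ^ n)\<^sup>2"]
    have "((\<lambda>t. (norm (real_freq k) ^ n)\<^sup>2 * (c t k \<bullet> c t k)) has_real_derivative f' k t) (at t within {0..T})"
      unfolding f'_def by (simp only: mult.left_commute mult.assoc)
    moreover have "f k = (\<lambda>t. (norm (real_freq k) ^ n)\<^sup>2 * (c t k \<bullet> c t k))"
      by (simp add: f_def fun_eq_iff dot_square_norm power_mult_distrib)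
    ultimately show ?thesis by (simp only:)
  qed
  have f'_cont: "continuous_on {0..T} (f' k)" for k
    unfolding f'_def by (intro continuous_intros c_cont c'_cont)
  have f'_bound: "\<bar>f' k t\<bar> \<le> 2 * D * C * inverse (norm (real_freq k) ^ 6)" if t: "t \<in> {0..T}" for k t
  proof -
    have "\<bar>f' k t\<bar> \<le> 2 * (norm (real_freq k) ^ n)\<^sup>2 * norm (cnj (c t k) * c' t k)"
      using abs_Re_le_cmod[of "cnj (c t k) * c' t k"] unfolding f'_def abs_mult
      by (intro mult_mono) auto
    also have "\<dots> \<le> 2 * (norm (real_freq k) ^ n)\<^sup>2 * (norm (c t k) * D)"
      unfolding norm_mult complex_mod_cnj by (intro mult_left_mono D t) auto
    also have "\<dots> = 2 * D * (norm (real_freq k) ^ (2 * n) * norm (c t k))"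
      by (simp add: power_mult[symmetric] mult_ac)
    also have "\<dots> \<le> 2 * D * (C * inverse (norm (real_freq k) ^ 6))"
      using D C t by (intro mult_left_mono decay_weighted) auto
    finally show ?thesis by (simp add: mult_ac)
  qed
  have dom: "(\<lambda>k. 2 * D * C * inverse (norm (real_freq k) ^ 6)) summable_on UNIV"
    by (intro summable_on_cmult_right summable_on_inverse_norm_6)
  have f'_summable: "(\<lambda>k. f' k t) summable_on UNIV" if t: "t \<in> {0..T}" for t
  proof (rule abs_summable_summable, rule summable_on_nonneg_comparison[OF dom])
    show "norm (f' k t) \<le> 2 * D * C * inverse (norm (real_freq k) ^ 6)" for k
      using f'_bound[OF t] by simp
  qed auto
  have E_deriv: "((\<lambda>t. sobolev_energy n (c t) + \<mu>) has_real_derivative (\<Sum>\<^sub>\<infinity>k. f' k t)) (at t within {0..T})"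
    if t: "t \<in> {0..T}" for t
  proof -
    have "(\<lambda>k. f k t) summable_on UNIV" if "t \<in> {0..T}" for t
      unfolding f_def by (rule rapid_square_summable[OF c_rapid[OF that]])
    from has_real_derivative_infsum[OF f_deriv f'_cont f'_bound dom this t]
    have "((\<lambda>t. \<Sum>\<^sub>\<infinity>k. f k t) has_real_derivative (\<Sum>\<^sub>\<infinity>k. f' k t)) (at t within {0..T})" .
    from DERIV_add[OF this DERIV_const[of \<mu>]] show ?thesis
      by (simp add: sobolev_energy_def f_def)
  qed
  have rate: "(\<Sum>\<^sub>\<infinity>k. f' k t) \<le> (9 * 2 ^ n * (8 * real n + 8) * (P + B) + 4 * B)
      * ((sobolev_energy n (c t) + \<mu>) * (1 + (sobolev_energy n (c t) + \<mu>)))" if "t \<in> {0<..<T}" for t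
  proof -
    have t: "t \<in> {0..T}" "0 < t" using that by auto
    let ?m = "\<lambda>l. MG_symbol 1 (real_freq l)"
    have eq: "c' t k = - (\<Sum>\<^sub>\<infinity>p. \<i> * of_real (?m (k - p) \<bullet> real_freq p) *
        ((c t (k - p) + b t (k - p)) * c t p + c t (k - p) * b t p))
        - of_real (\<mu> * (norm (real_freq k) + 1) + \<kappa> * norm (real_freq k) powr \<gamma>) * c t k
        - of_real (\<mu> * (norm (real_freq k) + 1)) * b t k" for k
    proof -
      let ?A = "\<lambda>p. \<i> * of_real (?m (k - p) \<bullet> real_freq p) * (a t (k - p) * a t p)"
      let ?B = "\<lambda>p. \<i> * of_real (?m (k - p) \<bullet> real_freq p) * (b t (k - p) * b t p)"
      have s: "?A summable_on UNIV" "?B summable_on UNIV"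
        using sol_transport(1)[OF sol, of t k] sol_transport(1)[OF sol0, of t k] t
        by (auto simp: a_def b_def summable_on_def)
      have "((\<lambda>p. ?A p + - ?B p) has_sum (infsum ?A UNIV + - infsum ?B UNIV)) UNIV"
        by (intro has_sum_add has_sum_uminusI has_sum_infsum s)
      \<comment> \<open>With a = c + b the difference a a - b b is split as a c + c b, where
        \<open>a\<close> in the first product is written out as \<open>c + b\<close>.\<close>
      moreover have "(\<lambda>p. ?A p + - ?B p) = (\<lambda>p. \<i> * of_real (?m (k - p) \<bullet> real_freq p) *
          ((c t (k - p) + b t (k - p)) * c t p + c t (k - p) * b t p))"
        by (simp add: fun_eq_iff c_def algebra_simps)
      ultimately have N: "(\<Sum>\<^sub>\<infinity>p. \<i> * of_real (?m (k - p) \<bullet> real_freq p) *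
          ((c t (k - p) + b t (k - p)) * c t p + c t (k - p) * b t p)) = infsum ?A UNIV - infsum ?B UNIV"
        by (simp add: infsumI)
      \<comment> \<open>The second solution has damping 0. The damping of \<open>a = c + b\<close>
        is therefore not compensated and leaves the source in \<open>b\<close>.\<close>
      show ?thesis
        unfolding N unfolding c'_def sol_ode[OF sol t(2)] sol_ode[OF sol0 t(2)] a_def[symmetric] b_def[symmetric] c_def
        by (simp add: algebra_simps)
    qed
    show ?thesis
      unfolding f'_def P_def
      by (rule energy_rate_bound[OF div_free_symbol_MG n c_rapid[OF t(1)] sym(1) b_rapid[OF t(1)] sym(2) \<mu> _ B[OF t(1)] eq
            f'_summable[OF t(1), unfolded f'_def]]) (use \<kappa> in auto)
  qed
  have init: "sobolev_energy n (c 0) = 0"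
  proof -
    have "\<theta> 0 = \<theta>\<^sub>0" "\<phi> 0 = \<theta>\<^sub>0"
      using sol sol0 by (auto simp: smooth_MG_solution_def)
    hence "c 0 = (\<lambda>k. 0)" by (auto simp: c_def a_def b_def torus_coeff_def)
    thus ?thesis by (simp add: sobolev_energy_def)
  qed
  have z: "z = sobolev_energy n (c T) + \<mu>"
    by (simp add: z_def c_def)
  have pos: "0 \<le> sobolev_energy n (c t) + \<mu>" for t
    using sobolev_energy_nonneg \<mu> by (intro add_nonneg_nonneg)
  from logistic_gronwall[OF T pos E_deriv rate] show ?thesis
    unfolding z init by simp
qed

section \<open>From the energy back to the Sobolev norm\<close>

lemma L2_norm_le:
  assumes "\<And>x. \<bar>h x\<bar> \<le> M"
  shows "L2_norm h \<le> sqrt (measure lborel torus_cell) * M"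
proof -
  have M: "0 \<le> M" using assms[of 0] by linarith
  have fin: "emeasure lborel torus_cell < \<infinity>"
    unfolding torus_cell_def by (rule emeasure_lborel_cbox_finite)
  have "(LINT x:torus_cell|lborel. (h x)\<^sup>2) \<le> (LINT x:torus_cell|lborel. M\<^sup>2)"
    unfolding set_lebesgue_integral_def
  \<comment> \<open>This form of monotonicity asks for integrability of the majorant only, so no
    measurability of \<open>h\<close> has to be shown.\<close>
  proof (rule integral_mono')
    show "integrable lborel (\<lambda>x. indicat_real torus_cell x *\<^sub>R M\<^sup>2)"
      using fin by (auto simp: torus_cell_def intro!: integrable_mult_left integrable_real_indicator)
    show "indicat_real torus_cell x *\<^sub>R (h x)\<^sup>2 \<le> indicat_real torus_cell x *\<^sub>R M\<^sup>2" for x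
      using power_mono[OF assms[of x], of 2] by (auto intro!: mult_left_mono)
  qed auto
  also have "\<dots> = measure lborel torus_cell * M\<^sup>2"
    by (simp add: set_lebesgue_integral_def torus_cell_def)
  finally have "L2_norm h \<le> sqrt (measure lborel torus_cell * M\<^sup>2)"
    unfolding L2_norm_def by (rule real_sqrt_le_mono)
  thus ?thesis using M by (simp add: real_sqrt_mult)
qed

text \<open>A single coefficient is at most the root of the energy times |k|^(-n), so the series for
  \<Lambda>^s converges absolutely with terms of size |k|^(-6), and its supremum bounds the L2 norm.
  The loss of six derivatives is harmless because \<open>n\<close> may be chosen after
  \<open>s\<close>.\<close>

lemma Hs_norm_le_sobolev_energy:
  assumes c: "rapid (fourier_coeff f)" and n: "s + 6 \<le> real n"
  shows "Hs_norm s f \<le> sqrt (measure lborel torus_cell) *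
    (sqrt (sobolev_energy n (fourier_coeff f)) * (\<Sum>\<^sub>\<infinity>k. inverse (norm (real_freq k) ^ 6)))"
  unfolding Hs_norm_def
proof (rule L2_norm_le)
  fix x
  let ?c = "fourier_coeff f" and ?g = "sqrt (sobolev_energy n (fourier_coeff f))"
  let ?t = "\<lambda>k. of_real (norm (real_freq k) powr s) * ?c k * cis (real_freq k \<bullet> x)"
  have le: "norm (?t k) \<le> ?g * inverse (norm (real_freq k) ^ 6)" for k
  proof (cases "k = 0")
    case False
    have r: "1 \<le> norm (real_freq k)" by (rule norm_real_freq_ge_1[OF False])
    have "norm (real_freq k) powr s * norm (real_freq k) ^ 6 = norm (real_freq k) powr (s + 6)"
      using r powr_realpow[of "norm (real_freq k)" 6] by (simp add: powr_add)
    also have "\<dots> \<le> norm (real_freq k) powr (real n)"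
      using r n by (intro powr_mono) auto
    also have "\<dots> = norm (real_freq k) ^ n"
      using r by (intro powr_realpow) auto
    finally have "norm (real_freq k) powr s * norm (real_freq k) ^ 6 * norm (?c k) \<le> norm (real_freq k) ^ n * norm (?c k)"
      by (rule mult_right_mono) simp
    also have "\<dots> \<le> ?g" by (rule le_sqrt_sobolev_energy[OF c])
    finally have "norm (real_freq k) powr s * norm (?c k) * norm (real_freq k) ^ 6 \<le> ?g" by (simp add: mult_ac)
    moreover have "0 < norm (real_freq k) ^ 6" using r by (intro zero_less_power) linarith
    ultimately have "norm (real_freq k) powr s * norm (?c k) \<le> ?g / norm (real_freq k) ^ 6"
      by (simp add: pos_le_divide_eq)
    thus ?thesis by (simp add: norm_mult divide_inverse)
  qed (simp add: rapid_zero[OF c])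
  have dom: "(\<lambda>k. ?g * inverse (norm (real_freq k) ^ 6)) summable_on UNIV"
    by (intro summable_on_cmult_right summable_on_inverse_norm_6)
  have s: "(\<lambda>k. norm (?t k)) summable_on UNIV"
    by (rule summable_on_nonneg_comparison[OF dom _ le]) auto
  have "\<bar>Lambda_pow s f x\<bar> \<le> norm (\<Sum>\<^sub>\<infinity>k. ?t k)"
    unfolding Lambda_pow_def fourier_multiplier_def by (rule abs_Re_le_cmod)
  also have "\<dots> \<le> (\<Sum>\<^sub>\<infinity>k. norm (?t k))" by (rule norm_infsum_bound[OF s])
  also have "\<dots> \<le> (\<Sum>\<^sub>\<infinity>k. ?g * inverse (norm (real_freq k) ^ 6))"
    by (rule infsum_mono[OF s dom le])
  also have "\<dots> = ?g * (\<Sum>\<^sub>\<infinity>k. inverse (norm (real_freq k) ^ 6))"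
    by (rule infsum_cmult_right) (rule summable_on_inverse_norm_6)
  finally show "\<bar>Lambda_pow s f x\<bar> \<le> ?g * (\<Sum>\<^sub>\<infinity>k. inverse (norm (real_freq k) ^ 6))" .
qed

theorem theorem7p3:
  fixes \<kappa> \<gamma> :: real
    and \<theta>\<^sub>0 S :: "real ^ 3 \<Rightarrow> real"
    and \<theta> :: "real \<Rightarrow> real \<Rightarrow> real ^ 3 \<Rightarrow> real"
  assumes "\<kappa> > 0" and "\<gamma> \<in> {0<..2}"
    and "smooth_torus \<theta>\<^sub>0" and "zero_mean \<theta>\<^sub>0"
    and "smooth_torus S" and "zero_mean S"
    and "\<And>\<mu>. \<mu> > 0 \<Longrightarrow> smooth_MG_solution \<kappa> \<gamma> \<mu> S \<theta>\<^sub>0 (\<theta> \<mu>)"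
    and "smooth_MG_solution \<kappa> \<gamma> 0 S \<theta>\<^sub>0 (\<theta> 0)"
  shows "\<forall>s\<ge>0. \<forall>t\<ge>0. ((\<lambda>\<mu>. Hs_norm s (\<lambda>x. \<theta> \<mu> t x - \<theta> 0 t x)) \<longlongrightarrow> 0) (at_right 0)"
proof (intro allI impI)
  fix s t :: real
  assume "0 \<le> s" and t: "0 \<le> t"
  note sol = assms(7) and sol0 = assms(8)
  \<comment> \<open>Large enough both for the energy estimate, \<open>n \<ge> 7\<close>, and for the
    loss of six derivatives above \<open>s\<close>.\<close>
  define n where "n = nat \<lceil>s\<rceil> + 7"
  have n: "n \<ge> 7" "s + 6 \<le> real n"
    using of_nat_ceiling[of s] unfolding n_def by linarith+
  define a where "a = (\<lambda>\<mu>. torus_coeff (\<lambda>(t, x). \<theta> \<mu> t x))"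
  define P where "P = (\<Sum>\<^sub>\<infinity>k. inverse (norm (real_freq k) ^ 6))"
  define V where "V = sqrt (measure lborel torus_cell)"
  have P0: "0 \<le> P" unfolding P_def by (rule infsum_nonneg) simp
  \<comment> \<open>Decay of order \<open>n + 1\<close> for the weight on \<open>b\<close> plus 6
    for summability, uniformly up to time \<open>t\<close>; it makes \<open>C * P\<close> an
    admissible \<open>B\<close>.\<close>
  obtain C where C: "0 \<le> C"
    "\<And>r k. r \<in> {0..t} \<Longrightarrow> norm (a 0 r k) \<le> C * inverse (norm (real_freq k) ^ (n + 1 + 6))"
    using sol_decay[OF sol0, of t "n + 1 + 6"] unfolding a_def by blast
  have B: "(\<Sum>\<^sub>\<infinity>k. norm (real_freq k) ^ (n + 1) * norm (a 0 r k)) \<le> C * P" if "r \<in> {0..t}" for r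
  proof -
    have "rapid (a 0 r)" unfolding a_def by (rule sol_rapid[OF sol0]) (use that in auto)
    from rapid_summable[OF this]
    have "(\<Sum>\<^sub>\<infinity>k. norm (real_freq k) ^ (n + 1) * norm (a 0 r k)) \<le> (\<Sum>\<^sub>\<infinity>k. C * inverse (norm (real_freq k) ^ 6))"
      by (rule infsum_mono) (intro summable_on_cmult_right summable_on_inverse_norm_6 decay_weighted C that)+
    thus ?thesis
      unfolding P_def by (subst (asm) infsum_cmult_right) (auto intro: summable_on_inverse_norm_6)
  qed
  define L where "L = exp ((9 * 2 ^ n * (8 * real n + 8) * (P + C * P) + 4 * (C * P)) * t)"
  \<comment> \<open>\<open>L\<close> does not depend on \<open>\<mu>\<close>. The smallness
    condition forces z / (1 + z) < 1/2, hence z < 1, and then z is at most twice z / (1 +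
    z).\<close>
  have bound: "Hs_norm s (\<lambda>x. \<theta> \<mu> t x - \<theta> 0 t x) \<le> V * (sqrt (2 * (\<mu> * L)) * P)" if \<mu>: "0 < \<mu>" "\<mu> * L < 1 / 2" for \<mu>
  proof -
    let ?f = "\<lambda>x. \<theta> \<mu> t x - \<theta> 0 t x"
    let ?c = "\<lambda>k. a \<mu> t k - a 0 t k"
    note cont = sol_continuous[OF sol[OF \<mu>(1)] t, of UNIV] sol_continuous[OF sol0 t, of UNIV]
    have coeff: "fourier_coeff ?f = ?c"
    proof
      fix k
      have "fourier_coeff ?f k = fcoeff (\<lambda>x. of_real (?f x)) k"
        by (intro fourier_coeff_eq_fcoeff continuous_intros cont)
      also have "\<dots> = fcoeff (\<lambda>x. of_real (\<theta> \<mu> t x) + (- 1) * of_real (\<theta> 0 t x)) k"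
        by simp
      also have "\<dots> = fcoeff (\<lambda>x. of_real (\<theta> \<mu> t x)) k + fcoeff (\<lambda>x. (- 1) * of_real (\<theta> 0 t x)) k"
        by (intro fcoeff_add continuous_intros cont)
      also have "\<dots> = ?c k"
        unfolding fcoeff_cmult by (simp add: a_def torus_coeff_def)
      finally show "fourier_coeff ?f k = ?c k" .
    qed
    define z where "z = sobolev_energy n ?c + \<mu>"
    have z0: "0 \<le> z" using sobolev_energy_nonneg[of n ?c] \<mu> by (simp add: z_def)
    have zL: "z / (1 + z) \<le> \<mu> * L"
      using difference_energy_bound[OF sol[OF \<mu>(1)] sol0 less_imp_le[OF assms(1)] less_imp_le[OF \<mu>(1)] t n(1)
          B[unfolded a_def]]
      by (simp add: z_def L_def P_def a_def)
    hence "z / (1 + z) < 1 / 2" using \<mu> by linarith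
    hence "z < 1" using z0 by (simp add: divide_less_eq)
    have "z = z / (1 + z) * (1 + z)" using z0 by simp
    also have "\<dots> \<le> \<mu> * L * 2"
      using zL \<open>z < 1\<close> z0 \<mu> by (intro mult_mono) (auto simp: L_def)
    finally have "sobolev_energy n ?c \<le> 2 * (\<mu> * L)"
      using \<mu> by (simp add: z_def)
    moreover have "rapid ?c"
      unfolding rapid_def
    proof
      fix N
      obtain C1 C2 where "\<And>k. norm (a \<mu> t k) \<le> C1 * inverse (norm (real_freq k) ^ N)"
        "\<And>k. norm (a 0 t k) \<le> C2 * inverse (norm (real_freq k) ^ N)"
        using sol_rapid[OF sol[OF \<mu>(1)] t] sol_rapid[OF sol0 t] unfolding rapid_def a_def by meson
      hence "norm (?c k) \<le> (C1 + C2) * inverse (norm (real_freq k) ^ N)" for k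
        unfolding distrib_right by (rule order_trans[OF norm_triangle_ineq4 add_mono])
      thus "\<exists>C. \<forall>k. norm (?c k) \<le> C * inverse (norm (real_freq k) ^ N)" by blast
    qed
    ultimately have "Hs_norm s ?f \<le> V * (sqrt (sobolev_energy n ?c) * P)"
      and "sqrt (sobolev_energy n ?c) \<le> sqrt (2 * (\<mu> * L))"
      using Hs_norm_le_sobolev_energy[of ?f s n] n(2) by (simp_all add: coeff V_def P_def)
    moreover have "V * (sqrt (sobolev_energy n ?c) * P) \<le> V * (sqrt (2 * (\<mu> * L)) * P)"
      using calculation(2) P0 by (intro mult_left_mono mult_right_mono) (auto simp: V_def)
    ultimately show ?thesis by linarith
  qed
  have lim: "((\<lambda>\<mu>. V * (sqrt (2 * (\<mu> * L)) * P)) \<longlongrightarrow> V * (sqrt (2 * (0 * L)) * P)) (at_right 0)"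
    by (intro tendsto_intros)
  have small: "\<forall>\<^sub>F \<mu> in at_right 0. \<mu> * L < 1 / 2"
  proof (rule order_tendstoD(2))
    show "((\<lambda>\<mu>. \<mu> * L) \<longlongrightarrow> 0 * L) (at_right 0)" by (intro tendsto_intros)
  qed simp
  show "((\<lambda>\<mu>. Hs_norm s (\<lambda>x. \<theta> \<mu> t x - \<theta> 0 t x)) \<longlongrightarrow> 0) (at_right 0)"
  proof (rule tendsto_sandwich[OF _ _ tendsto_const])
    show "\<forall>\<^sub>F \<mu> in at_right 0. 0 \<le> Hs_norm s (\<lambda>x. \<theta> \<mu> t x - \<theta> 0 t x)"
      by (simp add: Hs_norm_def L2_norm_def set_lebesgue_integral_def)
    show "\<forall>\<^sub>F \<mu> in at_right 0. Hs_norm s (\<lambda>x. \<theta> \<mu> t x - \<theta> 0 t x) \<le> V * (sqrt (2 * (\<mu> * L)) * P)"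
      using small eventually_at_right_less[of 0] by eventually_elim (rule bound)
  qed (use lim in simp)
qed

end
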